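(* Let $n\in\mathbb N$ and let $A$ be a real symmetric $n\times n$ matrix with positive eigenvalues. Let $H:\mathbb R^n\to\mathbb R$ be continuous, positively homogeneous of degree $\alpha>0$, with $H(x)>0$ for all $x\ne 0$, and having property (HC) on the unit sphere $\{x\in\mathbb R^n:|x|=1\}$. Let $t_*\ge 0$ and let $G:[t_*,\infty)\times\mathbb R^n\to\mathbb R^n$ be continuous, and suppose there are numbers $T_*\ge t_*$ and $c_*,r_*,\delta>0$ such that $|G(t,x)|\le c_*|x|^{1+\alpha+\delta}$ for all $t\ge T_*$ and all $x\in\mathbb R^n$ with $|x|\le r_*$. Let $y\in C^1([t_*,\infty),\mathbb R^n)$ satisfy $$y'=-H(y)Ay+G(t,y)\quad\text{on }(t_*,\infty),$$ $y(t)\ne 0$ for all $t\ge t_*$, and $\lim_{t\to\infty}y(t)=0$. Let $\Lambda$ be the eigenvalue of $A$ given by $\Lambda=\lim_{t\to\infty}\dfrac{y(t)\cdot Ay(t)}{|y(t)|^2}$. Then there exists a nonzero vector $\xi_*\in\mathbb R^n$ such that, as $t\to\infty$, $$|y(t)-\xi_* t^{-1/\alpha}|=\mathcal O(t^{-1/\alpha-\varepsilon})\quad\text{for some }\varepsilon>0.$$ In fact, $\xi_*$ is an eigenvector of $A$ associated with the eigenvalue $\Lambda$, and $$|R_\Lambda y(t)-\xi_* t^{-1/\alpha}|=\mathcal O(t^{-1/\alpha-\varepsilon})\quad\text{for some }\varepsilon>0.$$ Moreover, $$\alpha\Lambda H(\xi_* )=1.$$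
   Context: $|\cdot|$ is the Euclidean norm on $\mathbb R^n$. For nonnegative functions $f,g$ defined for large $t$, $f(t)=\mathcal O(g(t))$ as $t\to\infty$ means there are $T'$ and $C>0$ with $f(t)\le Cg(t)$ for all $t\ge T'$. A function $F:\mathbb R^n\to\mathbb R$ is positively homogeneous of degree $\beta>0$ if $F(tx)=t^\beta F(x)$ for all $x\in\mathbb R^n$ and $t>0$. Property (HC): for a nonempty set $E\subset\mathbb R^n$, a function $F:E\to\mathbb R$ (or the restriction to $E$ of a function on a larger set) has property (HC) on $E$ if for every $x_0\in E$ there exist $r,C,\gamma>0$ (which may depend on $x_0$) such that $|F(x)-F(x_0)|\le C|x-x_0|^\gamma$ for all $x\in E$ with $|x-x_0|<r$. For an eigenvalue $\lambda$ of $A$, $R_\lambda$ denotes the orthogonal projection of $\mathbb R^n$ onto the eigenspace of $A$ associated with $\lambda$. Under the stated hypotheses, the limit defining $\Lambda$ exists and is an eigenvalue of $A$ (a result proved earlier in the paper). *)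

theory Defs
  imports "HOL-Analysis.Analysis" "HOL-Library.Landau_Symbols"
begin

definition eigenspace :: "real^'n^'n \<Rightarrow> real \<Rightarrow> (real^'n) set" where
  "eigenspace A l = {v. A *v v = l *\<^sub>R v}"

definition eigenvector :: "real^'n^'n \<Rightarrow> real^'n \<Rightarrow> real \<Rightarrow> bool" where
  "eigenvector A v l \<longleftrightarrow> v \<noteq> 0 \<and> A *v v = l *\<^sub>R v"

text \<open>Only real eigenvalues are considered; for the symmetric matrices of interest there are no
  others.\<close>
definition eigenvalue :: "real^'n^'n \<Rightarrow> real \<Rightarrow> bool" where
  "eigenvalue A l \<longleftrightarrow> (\<exists>v. eigenvector A v l)"

definition orth_proj :: "'a::euclidean_space set \<Rightarrow> 'a \<Rightarrow> 'a" where
  "orth_proj S x = (THE p. p \<in> S \<and> (\<forall>s\<in>S. orthogonal (x - p) s))"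

lemma orth_proj_unique_exists:
  fixes S :: "'a::euclidean_space set"
  assumes S: "subspace S"
  shows "\<exists>!p. p \<in> S \<and> (\<forall>s\<in>S. orthogonal (x - p) s)"
proof -
  obtain p z where p: "p \<in> span S" and z: "\<And>w. w \<in> span S \<Longrightarrow> orthogonal z w" and x: "x = p + z"
    using orthogonal_subspace_decomp_exists[of S x] by blast
  have sp: "span S = S" using S by (simp add: span_eq_iff)
  show ?thesis
  proof (rule ex1I[of _ p])
    show "p \<in> S \<and> (\<forall>s\<in>S. orthogonal (x - p) s)" using p z x sp by auto
  next
    fix q assume q: "q \<in> S \<and> (\<forall>s\<in>S. orthogonal (x - q) s)"
    have pS: "p \<in> S" using p sp by simp
    have d: "q - p \<in> S" using q pS S by (simp add: subspace_diff)
    have "orthogonal (x - q) (q - p)" "orthogonal (x - p) (q - p)" using q z x sp d by auto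
    then have "(q - p) \<bullet> (q - p) = 0" by (simp add: orthogonal_def algebra_simps inner_commute)
    then show "q = p" by simp
  qed
qed

lemma subspace_eigenspace: "subspace (eigenspace A l)"
  by (auto simp: subspace_def eigenspace_def matrix_vector_right_distrib scaleR_add_right
      matrix_vector_mult_scaleR scaleR_left_commute)

definition pos_homogeneous :: "('a::real_vector \<Rightarrow> real) \<Rightarrow> real \<Rightarrow> bool" where
  "pos_homogeneous F \<beta> \<longleftrightarrow> (\<forall>x. \<forall>t>0. F (t *\<^sub>R x) = t powr \<beta> * F x)"

text \<open>Pointwise Hoelder continuity: radius, constant and exponent may all depend on the
  point.\<close>
definition HC :: "('a::real_normed_vector \<Rightarrow> real) \<Rightarrow> 'a set \<Rightarrow> bool" where
  "HC F E \<longleftrightarrow> (\<forall>x0\<in>E. \<exists>r>0. \<exists>C>0. \<exists>\<gamma>>0. \<forall>x\<in>E.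
     norm (x - x0) < r \<longrightarrow> \<bar>F x - F x0\<bar> \<le> C * norm (x - x0) powr \<gamma>)"

text \<open>Unlike \<open>C1_differentiable_on\<close>, the derivative is taken relative to \<open>S\<close>, hence is
  one-sided at a boundary point of an interval, and values outside \<open>S\<close> are irrelevant.\<close>
definition C1_on :: "real set \<Rightarrow> (real \<Rightarrow> 'a::real_normed_vector) \<Rightarrow> bool" where
  "C1_on S f \<longleftrightarrow> (\<exists>f'. continuous_on S f' \<and>
     (\<forall>t\<in>S. (f has_vector_derivative f' t) (at t within S)))"

end

theory Submission
  imports Defs
begin

text \<open>Write \<open>y = |y| v\<close> with \<open>|v| = 1\<close>. Since \<open>(|y|^{-\<alpha>})' = \<alpha> H(v) (v \<bullet> A v) + O(|y|^\<delta>)\<close> lies between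
  positive constants, \<open>|y|\<close> is comparable to \<open>t^{-1/\<alpha>}\<close>. Hence \<open>v' = - H(y) w + g\<close> with
  \<open>w = A v - (v \<bullet> A v) v\<close>, \<open>H(y)\<close> comparable to \<open>1/t\<close> and \<open>g = O(t^{-1-\<delta>/\<alpha>})\<close>, and up to an error of
  the latter order the Rayleigh quotient has derivative \<open>- 2 H(y) |w|^2\<close>, so that it converges to some
  \<open>\<Lambda>\<close>. The inequality \<open>|x \<bullet> B x| \<le> K |B x|^2\<close> for \<open>B = A - \<Lambda>\<close> gives an algebraic rate for this
  convergence, which makes \<open>t^\<eta> H(y) |w|^2\<close> integrable; by Young's inequality \<open>v\<close> converges with an
  algebraic rate to a unit vector \<open>u\<close>, and \<open>A u = \<Lambda> u\<close>, as otherwise the Rayleigh quotient would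
  decrease like \<open>- ln t\<close>. By the Hoelder condition at \<open>u\<close>, \<open>(|y|^{-\<alpha>})' = \<alpha> \<Lambda> H(u) + O(t^{-e})\<close>,
  and integration yields \<open>\<xi> = (\<alpha> \<Lambda> H(u))^{-1/\<alpha>} u\<close>.\<close>

section \<open>Selfadjoint operators\<close>

lemma symmetric_matrix_inner:
  fixes A :: "real^'n^'n"
  assumes "transpose A = A"
  shows "(A *v x) \<bullet> y = x \<bullet> (A *v y)"
  by (metis assms dot_lmul_matrix vector_transpose_matrix)

text \<open>Along \<open>x - s *\<^sub>R B x\<close> the form is a quadratic in \<open>s\<close>
  without constant term and with linear term \<open>- 2 * s * |B x|^2\<close>, so it would turn
  negative for small \<open>s > 0\<close> if \<open>B x\<close> were nonzero.\<close>

lemma selfadjoint_psd_null: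
  fixes B :: "'a::euclidean_space \<Rightarrow> 'a"
  assumes lin: "linear B" and sa: "\<And>x y. B x \<bullet> y = x \<bullet> B y"
    and psd: "\<And>x. 0 \<le> x \<bullet> B x" and null: "x \<bullet> B x = 0"
  shows "B x = 0"
proof (rule ccontr)
  assume nz: "B x \<noteq> 0"
  define z where "z = B x"
  have zz: "z \<bullet> z > 0" using nz by (simp add: z_def)
  have q: "0 \<le> s\<^sup>2 * (z \<bullet> B z) - 2 * s * (z \<bullet> z)" for s :: real
  proof -
    have "(x - s *\<^sub>R z) \<bullet> B (x - s *\<^sub>R z) = s\<^sup>2 * (z \<bullet> B z) - 2 * s * (z \<bullet> z)"
      using null sa[of x z]
      by (simp add: linear_diff[OF lin] linear_cmul[OF lin] inner_diff_left inner_diff_right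
          power2_eq_square algebra_simps flip: z_def)
    with psd show ?thesis by metis
  qed
  \<comment> \<open>Small enough that the quadratic term is at most half of the linear one; the
    \<open>+ 1\<close> covers the case \<open>z \<bullet> B z = 0\<close>.\<close>
  define s where "s = (z \<bullet> z) / (z \<bullet> B z + 1)"
  have p: "z \<bullet> B z + 1 > 0" using psd[of z] by simp
  have "s > 0" using zz p by (simp add: s_def)
  have "s * (z \<bullet> B z) \<le> z \<bullet> z"
    using psd[of z] zz p by (simp add: s_def field_simps)
  hence "s * (s * (z \<bullet> B z)) \<le> s * (z \<bullet> z)"
    using \<open>s > 0\<close> by simp
  moreover have "s * (z \<bullet> z) > 0" using \<open>s > 0\<close> zz by simp
  ultimately show False using q[of s] by (simp add: power2_eq_square mult.assoc)
qed

text \<open>The minimum of the Rayleigh quotient is an eigenvalue.\<close>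
lemma symmetric_positive_eigenvalues_coercive:
  fixes A :: "real^'n^'n"
  assumes sym: "transpose A = A" and pos: "\<And>l. eigenvalue A l \<Longrightarrow> l > 0"
  obtains a where "a > 0" "\<And>x. a * (x \<bullet> x) \<le> x \<bullet> (A *v x)"
proof -
  have cont: "continuous_on (sphere (0::real^'n) 1) (\<lambda>x. x \<bullet> (A *v x))"
    by (intro continuous_intros linear_continuous_on matrix_vector_mul_bounded_linear)
  obtain u where u: "norm u = 1"
    and min: "\<And>x. norm x = 1 \<Longrightarrow> u \<bullet> (A *v u) \<le> x \<bullet> (A *v x)"
    using continuous_attains_inf[OF compact_sphere _ cont] by auto
  define a where "a = u \<bullet> (A *v u)"
  have ge: "a * (x \<bullet> x) \<le> x \<bullet> (A *v x)" for x
  proof (cases "x = 0")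
    case False
    have "a \<le> sgn x \<bullet> (A *v sgn x)"
      unfolding a_def by (rule min) (use False in \<open>simp add: norm_sgn\<close>)
    also have "\<dots> = (x \<bullet> (A *v x)) / (norm x)\<^sup>2"
      by (simp add: sgn_div_norm matrix_vector_mult_scaleR power2_eq_square divide_simps)
    finally show ?thesis
      using False by (simp add: power2_norm_eq_inner field_simps)
  qed simp
  \<comment> \<open>Minimality of \<open>a\<close> makes the form of \<open>A - a\<close>
    nonnegative with a zero at \<open>u\<close>, so \<open>u\<close> lies in its kernel.\<close>
  let ?B = "\<lambda>x. A *v x - a *\<^sub>R x"
  have "?B u = 0"
  proof (rule selfadjoint_psd_null[where B = ?B])
    show "linear ?B"
      by (rule linearI) (simp_all add: matrix_vector_right_distrib matrix_vector_mult_scaleR algebra_simps)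
    show "?B x \<bullet> y = x \<bullet> ?B y" for x y
      using symmetric_matrix_inner[OF sym, of x y]
      by (simp add: inner_diff_left inner_diff_right)
    show "0 \<le> x \<bullet> ?B x" for x
      using ge[of x] by (simp add: inner_diff_right)
    have "u \<bullet> u = 1" using u by (simp add: norm_eq_1)
    then show "u \<bullet> ?B u = 0"
      by (simp add: inner_diff_right a_def)
  qed
  then have "eigenvalue A a"
    using u by (auto simp: eigenvalue_def eigenvector_def intro!: exI[of _ u])
  with pos ge that show thesis by blast
qed

text \<open>A Lojasiewicz inequality with exponent 1/2, which replaces the spectral decomposition.\<close>
lemma selfadjoint_quadratic_form_le:
  fixes B :: "'a::euclidean_space \<Rightarrow> 'a"
  assumes lin: "linear B" and sa: "\<And>x y. B x \<bullet> y = x \<bullet> B y"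
  obtains K where "K > 0" "\<And>x. \<bar>x \<bullet> B x\<bar> \<le> K * (norm (B x))\<^sup>2"
proof -
  define N where "N = {x. B x = 0}"
  have subN: "subspace N"
    using lin unfolding N_def by (rule linear_subspace_kernel)
  define R where "R = {x. \<forall>n\<in>N. orthogonal n x}"
  have subR: "subspace R"
    unfolding R_def by (rule subspace_orthogonal_to_vectors)
  have inj: "x = 0" if "x \<in> R" "B x = 0" for x
    using that by (auto simp: R_def N_def orthogonal_def)
  \<comment> \<open>On the orthogonal complement \<open>R\<close> of its kernel \<open>B\<close> is
    injective, hence bounded below in finite dimension; \<open>1 / e\<close> becomes the constant
    \<open>K\<close>.\<close>
  obtain e where e: "e > 0" "\<And>x. x \<in> R \<Longrightarrow> e * norm x \<le> norm (B x)"
    using injective_imp_isometric[of R B] subR lin inj closed_subspace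
    by (metis linear_conv_bounded_linear)
  have "\<bar>x \<bullet> B x\<bar> \<le> 1 / e * (norm (B x))\<^sup>2" for x
  proof -
    obtain p z where p: "p \<in> span N" and z: "\<And>w. w \<in> span N \<Longrightarrow> orthogonal z w" and x: "x = p + z"
      using orthogonal_subspace_decomp_exists[of N x] by blast
    have p0: "B p = 0" using p subN by (simp add: span_eq_iff[THEN iffD2] N_def)
    have zR: "z \<in> R"
      using z by (auto simp: R_def orthogonal_commute intro: span_base)
    have Bx: "B x = B z" by (simp add: x linear_add[OF lin] p0)
    \<comment> \<open>The kernel component drops out of the form because \<open>B\<close> is
      selfadjoint.\<close>
    have "p \<bullet> B z = 0" using sa[of p z] p0 by simp
    then have "\<bar>x \<bullet> B x\<bar> = \<bar>z \<bullet> B z\<bar>"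
      by (simp add: Bx x inner_add_left linear_add[OF lin] p0)
    also have "\<dots> \<le> norm z * norm (B z)" by (rule Cauchy_Schwarz_ineq2)
    also have "\<dots> \<le> (norm (B z) / e) * norm (B z)"
      using e(1) e(2)[OF zR] by (intro mult_right_mono) (simp_all add: field_simps)
    finally show ?thesis by (simp add: Bx power2_eq_square)
  qed
  with e(1) show thesis by (intro that[of "1/e"]) auto
qed

text \<open>Pythagoras. With \<open>s\<close> the leading term of the asymptotics, which lies in the
  eigenspace, it passes the estimate for \<open>y t\<close> on to its projection.\<close>

lemma norm_orth_proj_diff_le:
  fixes S :: "'a::euclidean_space set"
  assumes S: "subspace S" and s: "s \<in> S"
  shows "norm (orth_proj S x - s) \<le> norm (x - s)"
proof -
  have p: "orth_proj S x \<in> S" "\<forall>s\<in>S. orthogonal (x - orth_proj S x) s"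
    using theI'[OF orth_proj_unique_exists[OF S, of x]] unfolding orth_proj_def by auto
  then have "orthogonal (x - orth_proj S x) (orth_proj S x - s)"
    using S s by (simp add: subspace_diff)
  then have "(norm (x - s))\<^sup>2 = (norm (x - orth_proj S x))\<^sup>2 + (norm (orth_proj S x - s))\<^sup>2"
    using norm_add_Pythagorean by fastforce
  then show ?thesis by (simp add: power2_le_imp_le)
qed

section \<open>Differential inequalities\<close>

lemma nonincreasing_if_deriv_nonpos:
  fixes f f' :: "real \<Rightarrow> real"
  assumes "\<And>t. t \<ge> T \<Longrightarrow> (f has_real_derivative f' t) (at t)"
    and "\<And>t. t \<ge> T \<Longrightarrow> f' t \<le> 0" and "T \<le> s" "s \<le> t"
  shows "f t \<le> f s"
  using assms by (intro DERIV_nonpos_imp_nonincreasing[OF \<open>s \<le> t\<close>]) (meson order_trans)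

lemma nonincreasing_bounded_tendsto:
  fixes f :: "real \<Rightarrow> real"
  assumes mono: "\<And>s t. T \<le> s \<Longrightarrow> s \<le> t \<Longrightarrow> f t \<le> f s" and low: "\<And>t. t \<ge> T \<Longrightarrow> b \<le> f t"
  obtains l where "(f \<longlongrightarrow> l) at_top" "\<And>t. t \<ge> T \<Longrightarrow> l \<le> f t"
proof
  define l where "l = Inf (f ` {T..})"
  have bdd: "bdd_below (f ` {T..})" using low by (auto intro!: bdd_belowI)
  show le: "l \<le> f t" if "t \<ge> T" for t
    unfolding l_def using that bdd by (auto intro: cInf_lower)
  show "(f \<longlongrightarrow> l) at_top"
  proof (rule decreasing_tendsto)
    show "\<forall>\<^sub>F t in at_top. l \<le> f t"
      using eventually_ge_at_top[of T] by eventually_elim (rule le)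
    fix x assume "l < x"
    then obtain s where s: "s \<ge> T" "f s < x"
      unfolding l_def using cInf_lessD[of "f ` {T..}" x] by auto
    show "\<forall>\<^sub>F t in at_top. f t < x"
      using eventually_ge_at_top[of s] by eventually_elim (use mono s in \<open>meson le_less_trans\<close>)
  qed
qed

lemma has_real_derivative_powr_mult:
  fixes E :: "real \<Rightarrow> real"
  assumes "t > 0" "(E has_real_derivative E') (at t)"
  shows "((\<lambda>t. t powr k * E t) has_real_derivative (k * t powr (k - 1) * E t + t powr k * E')) (at t)"
  using assms by (auto intro!: derivative_eq_intros simp: algebra_simps)

text \<open>Adding this primitive to a function cancels an error \<open>c * t powr (-1 - d)\<close>
  in its derivative, which turns an almost monotone quantity into a monotone one.\<close>

lemma has_real_derivative_neg_powr:
  fixes c d :: real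
  assumes "t > 0" "d \<noteq> 0"
  shows "((\<lambda>t. c / d * t powr (-d)) has_real_derivative (- c * t powr (-1 - d))) (at t)"
proof (rule DERIV_cong[OF DERIV_cmult[OF has_real_derivative_powr[OF \<open>t > 0\<close>]]])
  have "-d - 1 = -1 - d" by simp
  then show "c / d * (- d * t powr (- d - 1)) = - c * t powr (-1 - d)"
    using \<open>d \<noteq> 0\<close> by (simp only:) simp
qed

text \<open>The integrating factor \<open>t powr k\<close> leaves the source
  \<open>S * t powr (k - d - 1)\<close>, which is integrable as \<open>k < d\<close>. The second
  summand of \<open>W\<close> is its integral from \<open>t\<close> to infinity, so \<open>W\<close>
  is nonincreasing and \<open>W T\<close> serves as \<open>M\<close>.\<close>

lemma decay_rate_of_differential_inequality:
  fixes E E' :: "real \<Rightarrow> real"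
  assumes "T > 0" "k < d"
    and dE: "\<And>t. t \<ge> T \<Longrightarrow> (E has_real_derivative E' t) (at t)"
    and le: "\<And>t. t \<ge> T \<Longrightarrow> E' t \<le> - (k / t) * E t + S * t powr (-1 - d)"
    and "S \<ge> 0"
  obtains M where "\<And>t. t \<ge> T \<Longrightarrow> E t \<le> M * t powr (-k)"
proof -
  define W where "W t = t powr k * E t + S / (d - k) * t powr (k - d)" for t
  define W' where "W' t = (k * t powr (k - 1) * E t + t powr k * E' t) - S * t powr (k - d - 1)" for t
  have dW: "(W has_real_derivative W' t) (at t)" if "t \<ge> T" for t
  proof -
    have "t > 0" using that \<open>T > 0\<close> by simp
    have "((\<lambda>t. S / (d - k) * t powr (k - d)) has_real_derivative (- S * t powr (k - d - 1))) (at t)"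
      using has_real_derivative_neg_powr[OF \<open>t > 0\<close>, of "d - k" S] \<open>k < d\<close>
      by (simp add: algebra_simps)
    from DERIV_add[OF has_real_derivative_powr_mult[OF \<open>t > 0\<close> dE[OF that]] this]
    show ?thesis unfolding W_def W'_def by simp
  qed
  have W'0: "W' t \<le> 0" if "t \<ge> T" for t
  proof -
    have t: "t > 0" using that \<open>T > 0\<close> by simp
    have "t powr k * E' t \<le> t powr k * (- (k / t) * E t + S * t powr (-1 - d))"
      using le[OF that] by (rule mult_left_mono) simp
    also have "\<dots> = - k * t powr (k - 1) * E t + S * t powr (k - d - 1)"
    proof -
      have "t powr (k - 1) = t powr k / t" using t by (simp add: powr_diff)
      moreover have "t powr (k - d - 1) = t powr k * t powr (-1 - d)"
        by (subst powr_add[symmetric]) (simp add: algebra_simps)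
      ultimately show ?thesis by (simp add: algebra_simps)
    qed
    finally show ?thesis by (simp add: W'_def)
  qed
  show thesis
  proof
    fix t assume t: "t \<ge> T"
    then have t0: "t > 0" using \<open>T > 0\<close> by simp
    have "t powr k * E t \<le> W t" using \<open>S \<ge> 0\<close> \<open>k < d\<close> by (simp add: W_def)
    also have "\<dots> \<le> W T" using dW W'0 order_refl t by (rule nonincreasing_if_deriv_nonpos)
    finally have "t powr (-k) * (t powr k * E t) \<le> t powr (-k) * W T"
      by (rule mult_left_mono) simp
    moreover have "t powr (-k) * t powr k = 1" using t0 by (simp flip: powr_add)
    ultimately show "E t \<le> W T * t powr (-k)"
      by (metis mult.assoc mult.commute mult_1)
  qed
qed

text \<open>For \<open>s \<le> t\<close> the increment of \<open>v\<close> is at most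
  \<open>\<phi> t - \<phi> s \<le> - \<phi> s\<close>. This yields the Cauchy property and, as
  \<open>t\<close> tends to infinity, the rate; \<open>\<phi>\<close> takes the place of an improper
  integral of \<open>norm (v' t)\<close>.\<close>

lemma convergence_rate_of_dominated_derivative:
  fixes v v' :: "real \<Rightarrow> 'a::banach"
  assumes "T > 0" "\<eta> > 0"
    and dv: "\<And>t. t \<ge> T \<Longrightarrow> (v has_vector_derivative v' t) (at t)"
    and d\<phi>: "\<And>t. t \<ge> T \<Longrightarrow> (\<phi> has_real_derivative \<phi>' t) (at t)"
    and le: "\<And>t. t \<ge> T \<Longrightarrow> norm (v' t) \<le> \<phi>' t"
    and low: "\<And>t. t \<ge> T \<Longrightarrow> - (P * t powr (-\<eta>)) \<le> \<phi> t" and up: "\<And>t. t \<ge> T \<Longrightarrow> \<phi> t \<le> 0"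
  obtains u where "\<And>t. t \<ge> T \<Longrightarrow> norm (v t - u) \<le> P * t powr (-\<eta>)"
proof -
  have step: "norm (v t - v s) \<le> P * s powr (-\<eta>)" if "T \<le> s" "s \<le> t" for s t
  proof (cases "s = t")
    case True
    then show ?thesis using low[of s] up[of s] that by simp
  next
    case False
    have "norm (v t - v s) \<le> \<phi> t - \<phi> s"
    proof (rule differentiable_bound_general)
      show "s < t" using False that by simp
      show "continuous_on {s..t} v"
        using dv that by (intro continuous_at_imp_continuous_on ballI)
          (meson atLeastAtMost_iff has_vector_derivative_continuous order_trans)
      show "continuous_on {s..t} \<phi>"
        using d\<phi> that by (intro continuous_at_imp_continuous_on ballI)
          (meson atLeastAtMost_iff DERIV_isCont order_trans)
      show "(v has_vector_derivative v' x) (at x)" if "s < x" "x < t" for x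
        using dv \<open>T \<le> s\<close> that by simp
      show "(\<phi> has_vector_derivative \<phi>' x) (at x)" if "s < x" "x < t" for x
        using d\<phi> \<open>T \<le> s\<close> that by (simp add: has_real_derivative_iff_has_vector_derivative)
      show "norm (v' x) \<le> \<phi>' x" if "s < x" "x < t" for x
        using le \<open>T \<le> s\<close> that by simp
    qed
    then show ?thesis using low[of s] up[of t] that by simp
  qed
  have lim0: "((\<lambda>t::real. P * t powr (-\<eta>)) \<longlongrightarrow> 0) at_top"
    using \<open>\<eta> > 0\<close> by (intro tendsto_mult_right_zero tendsto_neg_powr filterlim_ident) simp
  \<comment> \<open>Completeness is applied along integer times; the increment bound then covers
    every real \<open>t\<close>.\<close>
  have "Cauchy (\<lambda>n. v (real n))"
  proof (rule metric_CauchyI)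
    fix e :: real assume "e > 0"
    then have "\<forall>\<^sub>F t in at_top. P * t powr (-\<eta>) < e / 2"
      by (intro order_tendstoD[OF lim0]) simp
    then have "\<forall>\<^sub>F t in at_top. P * t powr (-\<eta>) < e / 2 \<and> t \<ge> T"
      using eventually_ge_at_top[of T] by eventually_elim simp
    then have "\<exists>N::nat. P * real N powr (-\<eta>) < e / 2 \<and> real N \<ge> T"
      using eventually_compose_filterlim[OF _ filterlim_real_sequentially]
        eventually_happens'[OF sequentially_bot] by blast
    then obtain N :: nat where N: "P * real N powr (-\<eta>) < e / 2" "real N \<ge> T" by blast
    have close: "dist (v (real n)) (v (real N)) < e / 2" if "n \<ge> N" for n
      using step[of "real N" "real n"] N that by (simp add: dist_norm)
    have "dist (v (real m)) (v (real n)) < e" if "m \<ge> N" "n \<ge> N" for m n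
      using close[OF that(1)] close[OF that(2)]
      by (metis dist_commute dist_triangle_half_r)
    then show "\<exists>M. \<forall>m\<ge>M. \<forall>n\<ge>M. dist (v (real m)) (v (real n)) < e" by blast
  qed
  then obtain u where u: "(\<lambda>n. v (real n)) \<longlonglongrightarrow> u"
    using Cauchy_convergent_iff convergent_def by blast
  show thesis
  proof
    fix t assume t: "t \<ge> T"
    have "(\<lambda>n. norm (v t - v (real n))) \<longlonglongrightarrow> norm (v t - u)"
      by (intro tendsto_intros u)
    moreover have "\<forall>\<^sub>F n in sequentially. norm (v t - v (real n)) \<le> P * t powr (-\<eta>)"
    proof -
      have "\<forall>\<^sub>F n in sequentially. t \<le> real n"
        by (rule eventually_compose_filterlim[OF eventually_ge_at_top filterlim_real_sequentially])
      then show ?thesis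
        by eventually_elim (metis step t norm_minus_commute)
    qed
    ultimately show "norm (v t - u) \<le> P * t powr (-\<eta>)"
      using tendsto_upperbound[OF _ _ sequentially_bot] by blast
  qed
qed

text \<open>Integration gives \<open>f t \<ge> a * (t - T)\<close> and
  \<open>f t \<le> f T + b * (t - T)\<close>; from \<open>2 * T\<close> on, \<open>a * T\<close> is
  at most half of \<open>a * t\<close>, and \<open>f T\<close> is at most
  \<open>f T / T * t\<close>.\<close>

lemma linear_growth_if_deriv_bounded:
  fixes f f' :: "real \<Rightarrow> real"
  assumes T: "T > 0" and a: "a > 0" and fT: "f T \<ge> 0"
    and df: "\<And>t. t \<ge> T \<Longrightarrow> (f has_real_derivative f' t) (at t)"
    and lo: "\<And>t. t \<ge> T \<Longrightarrow> a \<le> f' t" and hi: "\<And>t. t \<ge> T \<Longrightarrow> f' t \<le> b"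
  obtains c1 c2 where "c1 > 0" "c2 > 0" "\<And>t. t \<ge> 2 * T \<Longrightarrow> c1 * t \<le> f t" "\<And>t. t \<ge> 2 * T \<Longrightarrow> f t \<le> c2 * t"
proof
  show "a / 2 > 0" using a by simp
  have "b > 0" using lo[of T] hi[of T] a by simp
  then show "f T / T + b > 0" using fT T by (simp add: add_nonneg_pos)
  fix t assume t: "t \<ge> 2 * T"
  then have tT: "T \<le> t" using T by simp
  have "a * t - f t \<le> a * T - f T"
  proof (rule nonincreasing_if_deriv_nonpos[OF _ _ order_refl tT])
    show "((\<lambda>t. a * t - f t) has_real_derivative a - f' s) (at s)" if "s \<ge> T" for s
      using that by (auto intro!: derivative_eq_intros df)
  qed (use lo in auto)
  moreover have "a * (2 * T) \<le> a * t" using t a by simp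
  ultimately show "a / 2 * t \<le> f t" using fT by simp
  have "f t - b * t \<le> f T - b * T"
  proof (rule nonincreasing_if_deriv_nonpos[OF _ _ order_refl tT])
    show "((\<lambda>t. f t - b * t) has_real_derivative f' s - b) (at s)" if "s \<ge> T" for s
      using that by (auto intro!: derivative_eq_intros df)
  qed (use hi in auto)
  moreover have "f T \<le> f T / T * t" using mult_right_mono[OF tT fT] T by (simp add: field_simps)
  moreover have "0 \<le> b * T" using \<open>b > 0\<close> T by simp
  ultimately show "f t \<le> (f T / T + b) * t" by (simp add: distrib_right)
qed

text \<open>As \<open>e < 1\<close>, the primitive of the bound grows like
  \<open>t powr (1 - e)\<close>, which is at least 1 and so also absorbs the initial value.\<close>

lemma growth_of_deriv_le_powr:
  fixes g g' :: "real \<Rightarrow> real"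
  assumes T: "T \<ge> 1" and e: "e < 1"
    and dg: "\<And>t. t \<ge> T \<Longrightarrow> (g has_real_derivative g' t) (at t)"
    and le: "\<And>t. t \<ge> T \<Longrightarrow> g' t \<le> M * t powr (-e)" and "M \<ge> 0" "t \<ge> T"
  shows "g t \<le> (\<bar>g T\<bar> + M / (1 - e)) * t powr (1 - e)"
proof -
  let ?p = "\<lambda>t. M / (1 - e) * t powr (1 - e)"
  have "g t - ?p t \<le> g T - ?p T"
  proof (rule nonincreasing_if_deriv_nonpos[OF _ _ order_refl \<open>t \<ge> T\<close>])
    fix s assume s: "s \<ge> T"
    \<comment> \<open>The primitive of a negative power is taken with exponent parameter
      \<open>e - 1 < 0\<close> and coefficient \<open>- M\<close>.\<close>
    show "((\<lambda>t. g t - ?p t) has_real_derivative g' s - M * s powr (-e)) (at s)"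
      using DERIV_diff[OF dg[OF s] has_real_derivative_neg_powr[of s "e - 1" "- M"]] s T e
      by (simp add: minus_divide_left[symmetric] minus_divide_right minus_diff_eq)
    show "g' s - M * s powr (-e) \<le> 0" using le[OF s] by simp
  qed
  moreover have "0 \<le> ?p T" using \<open>M \<ge> 0\<close> e by simp
  moreover have "\<bar>g T\<bar> * 1 \<le> \<bar>g T\<bar> * t powr (1 - e)"
    using T \<open>t \<ge> T\<close> e by (intro mult_left_mono ge_one_powr_ge_zero) auto
  ultimately show ?thesis by (simp add: distrib_right)
qed

lemma linear_asymptotics_of_deriv:
  fixes f f' :: "real \<Rightarrow> real"
  assumes T: "T \<ge> 1" and e: "e < 1"
    and df: "\<And>t. t \<ge> T \<Longrightarrow> (f has_real_derivative f' t) (at t)"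
    and le: "\<And>t. t \<ge> T \<Longrightarrow> \<bar>f' t - K\<bar> \<le> M * t powr (-e)"
  obtains N where "\<And>t. t \<ge> T \<Longrightarrow> \<bar>f t - K * t\<bar> \<le> N * t powr (1 - e)"
proof
  fix t assume t: "t \<ge> T"
  have "0 \<le> M * T powr (-e)" using le[of T] by linarith
  moreover have "T powr (-e) > 0" using T by simp
  ultimately have M: "M \<ge> 0" by (simp add: zero_le_mult_iff)
  have "f t - K * t \<le> (\<bar>f T - K * T\<bar> + M / (1 - e)) * t powr (1 - e)"
  proof (rule growth_of_deriv_le_powr[OF T e _ _ M t])
    fix s assume s: "s \<ge> T"
    show "((\<lambda>t. f t - K * t) has_real_derivative f' s - K) (at s)"
      using s by (auto intro!: derivative_eq_intros df)
    show "f' s - K \<le> M * s powr (-e)" using le[OF s] by simp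
  qed
  moreover have "K * t - f t \<le> (\<bar>K * T - f T\<bar> + M / (1 - e)) * t powr (1 - e)"
  proof (rule growth_of_deriv_le_powr[OF T e _ _ M t])
    fix s assume s: "s \<ge> T"
    show "((\<lambda>t. K * t - f t) has_real_derivative K - f' s) (at s)"
      using s by (auto intro!: derivative_eq_intros df)
    show "K - f' s \<le> M * s powr (-e)" using le[OF s] by simp
  qed
  ultimately show "\<bar>f t - K * t\<bar> \<le> (\<bar>f T - K * T\<bar> + M / (1 - e)) * t powr (1 - e)"
    by (simp add: abs_minus_commute[of "K * T"] abs_le_iff)
qed

text \<open>Caratheodory's form of the derivative of \<open>x powr p\<close> at \<open>K\<close>:
  the difference quotient \<open>q\<close> is continuous there, hence bounded along
  \<open>f t / t\<close>, which tends to \<open>K\<close> at the rate \<open>t powr (-e)\<close>.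
  Multiplication by \<open>t powr p\<close> undoes the scaling.\<close>

lemma powr_asymptotics:
  fixes f :: "real \<Rightarrow> real"
  assumes T: "T > 0" and K: "K > 0" and e: "e > 0"
    and pos: "\<And>t. t \<ge> T \<Longrightarrow> f t > 0"
    and le: "\<And>t. t \<ge> T \<Longrightarrow> \<bar>f t - K * t\<bar> \<le> N * t powr (1 - e)"
  obtains L where "\<forall>\<^sub>F t in at_top. \<bar>f t powr p - (K * t) powr p\<bar> \<le> L * t powr (p - e)"
proof -
  obtain q where q: "\<And>x. x powr p - K powr p = q x * (x - K)" "isCont q K"
    using has_real_derivative_powr[OF K, of p] unfolding CARAT_DERIV by blast
  have dist: "\<bar>f t / t - K\<bar> \<le> N * t powr (-e)" if "t \<ge> T" for t
  proof -
    have t: "t > 0" using that T by simp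
    have "\<bar>f t / t - K\<bar> = \<bar>f t - K * t\<bar> / t" using t by (simp add: field_simps abs_divide[symmetric])
    also have "\<dots> \<le> N * t powr (1 - e) / t" using le[OF that] t by (simp add: divide_right_mono)
    also have "\<dots> = N * t powr (-e)" using t by (simp add: powr_diff powr_minus divide_simps)
    finally show ?thesis .
  qed
  have "((\<lambda>t. f t / t) \<longlongrightarrow> K) at_top"
  proof (rule LIM_zero_cancel[OF Lim_null_comparison])
    show "\<forall>\<^sub>F t in at_top. norm (f t / t - K) \<le> N * t powr (-e)"
      using eventually_ge_at_top[of T] by eventually_elim (use dist in simp)
    show "((\<lambda>t. N * t powr (-e)) \<longlongrightarrow> 0) at_top"
      using e by (intro tendsto_mult_right_zero tendsto_neg_powr filterlim_ident) simp
  qed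
  then have "((\<lambda>t. \<bar>q (f t / t)\<bar>) \<longlongrightarrow> \<bar>q K\<bar>) at_top"
    by (intro tendsto_rabs isCont_tendsto_compose[OF q(2)])
  then have "\<forall>\<^sub>F t in at_top. \<bar>q (f t / t)\<bar> < \<bar>q K\<bar> + 1"
    by (rule order_tendstoD) simp
  then have "\<forall>\<^sub>F t in at_top. \<bar>f t powr p - (K * t) powr p\<bar> \<le> (\<bar>q K\<bar> + 1) * N * t powr (p - e)"
    using eventually_ge_at_top[of T]
  proof eventually_elim
    case (elim t)
    have t: "t > 0" using elim T by simp
    have "f t powr p - (K * t) powr p = ((f t / t) powr p - K powr p) * t powr p"
      using t K pos[OF elim(2)] by (simp add: powr_mult powr_divide left_diff_distrib)
    then have "\<bar>f t powr p - (K * t) powr p\<bar> = \<bar>q (f t / t)\<bar> * \<bar>f t / t - K\<bar> * t powr p"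
      by (simp add: q abs_mult)
    also have "\<dots> \<le> (\<bar>q K\<bar> + 1) * (N * t powr (-e)) * t powr p"
      using elim dist[OF elim(2)] by (intro mult_right_mono mult_mono) auto
    also have "\<dots> = (\<bar>q K\<bar> + 1) * N * t powr (p - e)"
    proof -
      have "t powr (p - e) = t powr (-e) * t powr p" by (subst powr_add[symmetric]) simp
      then show ?thesis by simp
    qed
    finally show ?case .
  qed
  then show thesis by (rule that)
qed

section \<open>The normalized flow\<close>

text \<open>This is the equation of the direction \<open>y / |y|\<close>, with \<open>h\<close>
  standing for \<open>H(y)\<close>. The field multiplied by \<open>h\<close> is half the gradient of
  the Rayleigh quotient on the sphere, so up to \<open>g\<close> it is a gradient flow slowed down
  by a factor of order \<open>1 / t\<close>, and a Lojasiewicz argument applies.\<close>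

lemma rayleigh_flow_converges:
  fixes A :: "real^'n^'n" and v g :: "real \<Rightarrow> real^'n" and h :: "real \<Rightarrow> real"
  assumes sym: "transpose A = A" and T: "T \<ge> 1" and d: "d > 0" and h1: "h1 > 0"
    and nv: "\<And>t. t \<ge> T \<Longrightarrow> norm (v t) = 1"
    and dv: "\<And>t. t \<ge> T \<Longrightarrow> (v has_vector_derivative
      (- (h t *\<^sub>R (A *v v t - (v t \<bullet> (A *v v t)) *\<^sub>R v t)) + g t)) (at t)"
    and hl: "\<And>t. t \<ge> T \<Longrightarrow> h1 / t \<le> h t" and hu: "\<And>t. t \<ge> T \<Longrightarrow> h t \<le> h2 / t"
    and g: "\<And>t. t \<ge> T \<Longrightarrow> norm (g t) \<le> C * t powr (-1 - d)"
  obtains u \<Lambda> T' M \<eta> where "norm u = 1" "A *v u = \<Lambda> *\<^sub>R u" "((\<lambda>t. v t \<bullet> (A *v v t)) \<longlongrightarrow> \<Lambda>) at_top"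
    "\<eta> > 0" "T' \<ge> T" "\<And>t. t \<ge> T' \<Longrightarrow> norm (v t - u) \<le> M * t powr (-\<eta>)"
proof -

  \<comment> \<open>Notation and a priori bounds\<close>
  define rq where "rq t = v t \<bullet> (A *v v t)" for t
  define w where "w t = A *v v t - rq t *\<^sub>R v t" for t
  define v' where "v' t = - (h t *\<^sub>R w t) + g t" for t
  have dv': "(v has_vector_derivative v' t) (at t)" if "t \<ge> T" for t
    using dv[OF that] by (simp add: v'_def w_def rq_def)
  have pos: "t > 0" if "t \<ge> T" for t using that T by simp
  have hpos: "h t > 0" if "t \<ge> T" for t
    using hl[OF that] h1 pos[OF that] by (meson divide_pos_pos less_le_trans)
  have vv: "v t \<bullet> v t = 1" if "t \<ge> T" for t
    using nv[OF that] by (simp add: norm_eq_1)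
  obtain a where a: "a > 0" "\<And>x. norm (A *v x) \<le> a * norm x"
    using bounded_linear.pos_bounded[OF matrix_vector_mul_bounded_linear[of A]]
    by (metis mult.commute)
  have C0: "C \<ge> 0"
  proof -
    have "0 \<le> C * T powr (-1 - d)" using g[of T] norm_ge_zero order_trans by blast
    moreover have "T powr (-1 - d) > 0" using T by simp
    ultimately show ?thesis by (simp add: zero_le_mult_iff)
  qed
  have Av: "norm (A *v v t) \<le> a" if "t \<ge> T" for t
    using a(2)[of "v t"] nv[OF that] by simp
  have w2: "(norm (w t))\<^sup>2 = (A *v v t) \<bullet> w t" if "t \<ge> T" for t
    using vv[OF that] unfolding power2_norm_eq_inner w_def
    by (simp add: inner_diff_left inner_diff_right inner_commute rq_def)

  \<comment> \<open>Derivative of the Rayleigh quotient\<close>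
  define D where "D = 2 * a * C"
  have D0: "D \<ge> 0" using a C0 by (simp add: D_def)
  define rq' where "rq' t = - 2 * h t * (norm (w t))\<^sup>2 + 2 * ((A *v v t) \<bullet> g t)" for t
  have drq: "(rq has_real_derivative rq' t) (at t)" if t: "t \<ge> T" for t
  proof -
    have "((\<lambda>t. A *v v t) has_vector_derivative A *v v' t) (at t)"
      by (rule bounded_linear.has_vector_derivative[OF matrix_vector_mul_bounded_linear dv'[OF t]])
    from bounded_bilinear.has_vector_derivative[OF bounded_bilinear_inner dv'[OF t] this]
    have "(rq has_vector_derivative (v t \<bullet> (A *v v' t) + v' t \<bullet> (A *v v t))) (at t)"
      unfolding rq_def .
    also have "v t \<bullet> (A *v v' t) + v' t \<bullet> (A *v v t) = 2 * ((A *v v t) \<bullet> v' t)"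
      using symmetric_matrix_inner[OF sym, of "v t" "v' t"] by (simp add: inner_commute)
    also have "\<dots> = rq' t"
      using w2[OF t] by (simp add: v'_def rq'_def inner_add_right inner_diff_right algebra_simps)
    finally show ?thesis by (simp add: has_real_derivative_iff_has_vector_derivative)
  qed
  have rq'le: "rq' t \<le> - 2 * h t * (norm (w t))\<^sup>2 + D * t powr (-1 - d)" if t: "t \<ge> T" for t
  proof -
    have "(A *v v t) \<bullet> g t \<le> norm (A *v v t) * norm (g t)" by (rule norm_cauchy_schwarz)
    also have "\<dots> \<le> a * (C * t powr (-1 - d))"
      using Av[OF t] g[OF t] a by (intro mult_mono) auto
    finally show ?thesis by (simp add: rq'_def D_def)
  qed

  \<comment> \<open>The added term cancels the error \<open>D * t powr (-1 - d)\<close>, so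
    \<open>E0\<close> is nonincreasing; it tends to 0, so \<open>E0\<close> and \<open>rq\<close>
    share their limit.\<close>
  define E0 where "E0 t = rq t + D / d * t powr (-d)" for t
  define E' where "E' t = rq' t - D * t powr (-1 - d)" for t
  have dE0: "(E0 has_real_derivative E' t) (at t)" if t: "t \<ge> T" for t
    unfolding E0_def E'_def
    using DERIV_add[OF drq[OF t] has_real_derivative_neg_powr[OF pos[OF t], of d D]] d by simp
  have E'le: "E' t \<le> - 2 * h t * (norm (w t))\<^sup>2" if t: "t \<ge> T" for t
    using rq'le[OF t] by (simp add: E'_def)
  have E'0: "E' t \<le> 0" if t: "t \<ge> T" for t
  proof -
    have "0 \<le> h t * (norm (w t))\<^sup>2" using hpos[OF t] by simp
    then show ?thesis using E'le[OF t] by linarith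
  qed
  have E0low: "- a \<le> E0 t" if t: "t \<ge> T" for t
  proof -
    have "\<bar>rq t\<bar> \<le> norm (v t) * norm (A *v v t)"
      unfolding rq_def by (rule Cauchy_Schwarz_ineq2)
    then have "\<bar>rq t\<bar> \<le> a" using Av[OF t] nv[OF t] by simp
    moreover have "0 \<le> D / d * t powr (-d)" using D0 d by simp
    ultimately show ?thesis unfolding E0_def by linarith
  qed
  obtain \<Lambda> where \<Lambda>: "(E0 \<longlongrightarrow> \<Lambda>) at_top" "\<And>t. t \<ge> T \<Longrightarrow> \<Lambda> \<le> E0 t"
  proof (rule nonincreasing_bounded_tendsto[of T E0 "-a"])
    show "E0 t \<le> E0 s" if "T \<le> s" "s \<le> t" for s t
      using dE0 E'0 that by (rule nonincreasing_if_deriv_nonpos)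
  qed (use E0low in auto)
  have err0: "((\<lambda>t. D / d * t powr (-d)) \<longlongrightarrow> 0) at_top"
    using d by (intro tendsto_mult_right_zero tendsto_neg_powr filterlim_ident) simp
  have rqlim: "(rq \<longlongrightarrow> \<Lambda>) at_top"
    using tendsto_diff[OF \<Lambda>(1) err0] by (simp add: E0_def)

  define E where "E t = E0 t - \<Lambda>" for t
  have E0: "E t \<ge> 0" if "t \<ge> T" for t using \<Lambda>(2)[OF that] by (simp add: E_def)
  have dE: "(E has_real_derivative E' t) (at t)" if "t \<ge> T" for t
    unfolding E_def using DERIV_diff[OF dE0[OF that] DERIV_const[of \<Lambda>]] by simp
  have rqE: "rq t - \<Lambda> = E t - D / d * t powr (-d)" for t by (simp add: E_def E0_def)

  \<comment> \<open>Lojasiewicz inequality along the flow\<close>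
  let ?B = "\<lambda>x. A *v x - \<Lambda> *\<^sub>R x"
  have linB: "linear ?B"
    by (rule linearI) (simp_all add: matrix_vector_right_distrib matrix_vector_mult_scaleR algebra_simps)
  have saB: "?B x \<bullet> y = x \<bullet> ?B y" for x y
    using symmetric_matrix_inner[OF sym, of x y] by (simp add: inner_diff_left inner_diff_right)
  obtain K where K: "K > 0" "\<And>x. \<bar>x \<bullet> ?B x\<bar> \<le> K * (norm (?B x))\<^sup>2"
    using selfadjoint_quadratic_form_le[OF linB saB] by blast
  have "((\<lambda>t. \<bar>rq t - \<Lambda>\<bar>) \<longlongrightarrow> \<bar>\<Lambda> - \<Lambda>\<bar>) at_top"
    by (intro tendsto_intros rqlim)
  \<comment> \<open>Below this threshold \<open>K * (rq t - \<Lambda>)^2\<close> is at most half of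
    \<open>\<bar>rq t - \<Lambda>\<bar>\<close>.\<close>
  then have "\<forall>\<^sub>F t in at_top. \<bar>rq t - \<Lambda>\<bar> < 1 / (2 * K)"
    using K(1) by (intro order_tendstoD(2)[where y = "\<bar>\<Lambda> - \<Lambda>\<bar>"]) auto
  then obtain T1 where T1: "\<And>t. t \<ge> T1 \<Longrightarrow> \<bar>rq t - \<Lambda>\<bar> < 1 / (2 * K)"
    by (auto simp: eventually_at_top_linorder)
  define T2 where "T2 = max T T1"
  have T2: "T2 \<ge> T" "T2 \<ge> T1" by (auto simp: T2_def)

  \<comment> \<open>\<open>?B (v t)\<close> is the orthogonal sum of \<open>w t\<close> and
    \<open>(rq t - \<Lambda>) *\<^sub>R v t\<close>; the second part, being quadratic in
    \<open>rq t - \<Lambda>\<close>, is absorbed into the left-hand side.\<close>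
  have loj: "\<bar>rq t - \<Lambda>\<bar> / (2 * K) \<le> (norm (w t))\<^sup>2" if "t \<ge> T2" for t
  proof -
    have t: "t \<ge> T" "t \<ge> T1" using that T2 by auto
    have q: "v t \<bullet> ?B (v t) = rq t - \<Lambda>"
      using vv[OF t(1)] by (simp add: inner_diff_right rq_def)
    have "v t \<bullet> w t = 0"
      using vv[OF t(1)] by (simp add: w_def inner_diff_right rq_def)
    moreover have "?B (v t) = w t + (rq t - \<Lambda>) *\<^sub>R v t"
      by (simp add: w_def algebra_simps)
    ultimately have "(norm (?B (v t)))\<^sup>2 = (norm (w t))\<^sup>2 + (rq t - \<Lambda>)\<^sup>2"
      using vv[OF t(1)] unfolding power2_norm_eq_inner
      by (simp add: inner_add_left inner_add_right inner_commute[of "w t" "v t"] power2_eq_square)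
    then have "\<bar>rq t - \<Lambda>\<bar> \<le> K * ((norm (w t))\<^sup>2 + (rq t - \<Lambda>)\<^sup>2)"
      using K(2)[of "v t"] q by simp
    moreover have "K * (rq t - \<Lambda>)\<^sup>2 \<le> \<bar>rq t - \<Lambda>\<bar> / 2"
    proof -
      have "K * \<bar>rq t - \<Lambda>\<bar> \<le> 1 / 2" using T1[OF t(2)] K(1) by (simp add: field_simps)
      then have "K * \<bar>rq t - \<Lambda>\<bar> * \<bar>rq t - \<Lambda>\<bar> \<le> 1 / 2 * \<bar>rq t - \<Lambda>\<bar>"
        by (rule mult_right_mono) simp
      then show ?thesis by (simp add: power2_eq_square mult.assoc)
    qed
    ultimately have "\<bar>rq t - \<Lambda>\<bar> / 2 \<le> K * (norm (w t))\<^sup>2" by (simp add: distrib_left)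
    then show ?thesis using K(1) by (simp add: field_simps)
  qed

  \<comment> \<open>Algebraic decay of the Lyapunov function\<close>
  define k where "k = min (h1 / K) (d / 2)"
  have "k > 0" using h1 K(1) d by (simp add: k_def)
  moreover have "k \<le> d / 2" "k \<le> h1 / K"
    unfolding k_def by (rule min.cobounded2, rule min.cobounded1)
  ultimately have k: "k > 0" "k < d" "k \<le> h1 / K" using d by simp_all
  \<comment> \<open>The dissipation combined with \<open>loj\<close> gives the rate
    \<open>h1 / K\<close>; the second entry of the minimum in \<open>k\<close> ensures
    \<open>k < d\<close>, so that the source stays integrable against
    \<open>t powr k\<close>.\<close>
  have Edecay: "E' t \<le> - (k / t) * E t + k * D / d * t powr (-1 - d)" if "t \<ge> T2" for t
  proof -
    have t: "t \<ge> T" "t > 0" using that T2 pos[of t] by auto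
    have "k / t * \<bar>rq t - \<Lambda>\<bar> \<le> 2 * (h1 / t) * (\<bar>rq t - \<Lambda>\<bar> / (2 * K))"
      using mult_right_mono[OF k(3), of "\<bar>rq t - \<Lambda>\<bar>"] t K(1) by (simp add: field_simps)
    also have "\<dots> \<le> 2 * h t * (norm (w t))\<^sup>2"
      using loj[OF that] hl[OF t(1)] hpos[OF t(1)] h1 t K(1) by (intro mult_mono) auto
    finally have "E' t \<le> - (k / t * \<bar>rq t - \<Lambda>\<bar>)" using E'le[OF t(1)] by linarith
    \<comment> \<open>Without the absolute value, \<open>rq t - \<Lambda>\<close> is
      \<open>E t\<close> minus the correction term, and the latter produces the source.\<close>
    also have "\<dots> \<le> - (k / t * (rq t - \<Lambda>))"
      using k(1) t by (simp add: divide_right_mono mult_left_mono)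
    also have "\<dots> = - (k / t) * E t + k * D / d * (t powr (-d) / t)"
      unfolding rqE by (simp add: algebra_simps)
    also have "t powr (-d) / t = t powr (-1 - d)"
      using t by (simp add: powr_diff powr_minus divide_simps)
    finally show ?thesis .
  qed
  obtain M where M: "\<And>t. t \<ge> T2 \<Longrightarrow> E t \<le> M * t powr (-k)"
    by (rule decay_rate_of_differential_inequality[of T2 k d E E' "k * D / d"])
      (use T T2 k d D0 dE Edecay in auto)

  \<comment> \<open>Convergence of the direction with a rate\<close>
  define \<eta> where "\<eta> = k / 2"
  have \<eta>: "\<eta> > 0" "\<eta> \<le> d" using k d by (auto simp: \<eta>_def)
  \<comment> \<open>The summands of \<open>S\<close> pay for the derivative of the weight
    \<open>t powr \<eta>\<close>, for the remainder in Young's inequality and for \<open>g\<close>.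
    As \<open>\<eta>\<close> is half of \<open>k\<close>, the weighted \<open>E\<close> still decays
    like \<open>t powr (-\<eta>)\<close>.\<close>
  define S where "S = \<eta> * M / 4 + h2 / 2 + C"
  define \<phi> where "\<phi> t = - (1/4) * (t powr \<eta> * E t) - S / \<eta> * t powr (-\<eta>)" for t
  define \<phi>' where "\<phi>' t = - (1/4) * (\<eta> * t powr (\<eta> - 1) * E t + t powr \<eta> * E' t) + S * t powr (-1 - \<eta>)" for t
  have M0: "M \<ge> 0"
  proof -
    have "0 \<le> M * T2 powr (-k)" using M[of T2] E0[OF T2(1)] by simp
    moreover have "T2 powr (-k) > 0" using T T2 by simp
    ultimately show ?thesis by (simp add: zero_le_mult_iff)
  qed
  have h20: "h2 \<ge> 0"
  proof -
    have "0 \<le> h2 / T" using hpos[of T] hu[of T] by simp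
    then show ?thesis using T by (simp add: zero_le_divide_iff)
  qed
  have S0: "S \<ge> 0" using M0 h20 C0 \<eta> by (simp add: S_def)
  have d\<phi>: "(\<phi> has_real_derivative \<phi>' t) (at t)" if "t \<ge> T2" for t
  proof -
    have t: "t \<ge> T" "t > 0" using that T2 pos[of t] by auto
    have 1: "((\<lambda>t. S / \<eta> * t powr (-\<eta>)) has_real_derivative - S * t powr (-1 - \<eta>)) (at t)"
      using has_real_derivative_neg_powr[OF t(2), of \<eta> S] \<eta> by simp
    show ?thesis
      using DERIV_diff[OF DERIV_cmult[OF has_real_derivative_powr_mult[OF t(2) dE[OF t(1)]], of "-(1/4)" \<eta>] 1]
      unfolding \<phi>_def \<phi>'_def by simp
  qed
  have v'le: "norm (v' t) \<le> \<phi>' t" if "t \<ge> T2" for t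
  proof -
    have t: "t \<ge> T" "t > 0" "t \<ge> 1" using that T2 pos[of t] T by auto
    \<comment> \<open>The weight makes the square part of the weighted dissipation
      \<open>- E' t\<close>, while the remainder times \<open>h t\<close> is of the integrable order
      \<open>t powr (-1 - \<eta>)\<close>.\<close>
    have young: "norm (w t) \<le> (t powr \<eta> * (norm (w t))\<^sup>2 + t powr (-\<eta>)) / 2"
    proof -
      define p where "p = t powr (\<eta>/2)"
      have p: "p > 0" "t powr \<eta> = p * p" "t powr (-\<eta>) = inverse (p * p)"
        using t by (simp_all add: p_def powr_minus flip: powr_add)
      have "(p * norm (w t) - inverse p)\<^sup>2 = p * p * (norm (w t))\<^sup>2 + inverse (p * p) - 2 * norm (w t)"
        using p(1) by (simp add: power2_eq_square field_simps)
      moreover have "0 \<le> (p * norm (w t) - inverse p)\<^sup>2" by simp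
      ultimately show ?thesis unfolding p(2,3) by simp
    qed
    have "norm (v' t) \<le> norm (h t *\<^sub>R w t) + norm (g t)"
      unfolding v'_def by (metis norm_minus_cancel norm_triangle_ineq)
    also have "\<dots> \<le> h t * norm (w t) + C * t powr (-1 - d)"
      using g[OF t(1)] hpos[OF t(1)] by simp
    also have "h t * norm (w t) \<le> h t * ((t powr \<eta> * (norm (w t))\<^sup>2 + t powr (-\<eta>)) / 2)"
      using young hpos[OF t(1)] by (intro mult_left_mono) auto
    also have "\<dots> = t powr \<eta> * (2 * h t * (norm (w t))\<^sup>2) / 4 + h t * t powr (-\<eta>) / 2"
      by (simp add: algebra_simps)
    also have "t powr \<eta> * (2 * h t * (norm (w t))\<^sup>2) \<le> t powr \<eta> * (- E' t)"
      using E'le[OF t(1)] by (intro mult_left_mono) auto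
    also have "h t * t powr (-\<eta>) \<le> h2 * t powr (-1 - \<eta>)"
    proof -
      have "h t * t powr (-\<eta>) \<le> h2 / t * t powr (-\<eta>)"
        using hu[OF t(1)] by (rule mult_right_mono) simp
      also have "\<dots> = h2 * t powr (-1 - \<eta>)"
        using t by (simp add: powr_diff powr_minus divide_simps)
      finally show ?thesis .
    qed
    also have "C * t powr (-1 - d) \<le> C * t powr (-1 - \<eta>)"
      using C0 t \<eta> by (intro mult_left_mono powr_mono) auto
    finally have *: "norm (v' t) \<le> - (t powr \<eta> * E' t) / 4 + h2 * t powr (-1 - \<eta>) / 2 + C * t powr (-1 - \<eta>)"
      by simp
    have "t powr (\<eta> - 1) * E t \<le> t powr (\<eta> - 1) * (M * t powr (-k))"
      using M[OF that] by (rule mult_left_mono) simp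
    also have "\<dots> = M * t powr (-1 - \<eta>)"
    proof -
      have "\<eta> - 1 + - k = -1 - \<eta>" unfolding \<eta>_def by linarith
      then have "t powr (\<eta> - 1) * t powr (-k) = t powr (-1 - \<eta>)" by (metis powr_add)
      then show ?thesis by (simp add: algebra_simps)
    qed
    finally have "\<eta> * (t powr (\<eta> - 1) * E t) \<le> \<eta> * (M * t powr (-1 - \<eta>))"
      using \<eta> by (intro mult_left_mono) auto
    with * show ?thesis by (simp add: \<phi>'_def S_def algebra_simps)
  qed
  have \<phi>up: "\<phi> t \<le> 0" if "t \<ge> T2" for t
  proof -
    have "0 \<le> t powr \<eta> * E t" using E0[of t] that T2 by simp
    moreover have "0 \<le> S / \<eta> * t powr (-\<eta>)" using S0 \<eta> by simp
    ultimately show ?thesis by (simp add: \<phi>_def)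
  qed
  have \<phi>low: "- ((M / 4 + S / \<eta>) * t powr (-\<eta>)) \<le> \<phi> t" if "t \<ge> T2" for t
  proof -
    have "t powr \<eta> * E t \<le> t powr \<eta> * (M * t powr (-k))"
      using M[OF that] by (rule mult_left_mono) simp
    also have "\<dots> = M * t powr (-\<eta>)"
    proof -
      have "\<eta> + - k = - \<eta>" unfolding \<eta>_def by linarith
      then have "t powr \<eta> * t powr (-k) = t powr (-\<eta>)" by (metis powr_add)
      then show ?thesis by (simp add: algebra_simps)
    qed
    finally show ?thesis by (simp add: \<phi>_def algebra_simps)
  qed
  obtain u where u: "\<And>t. t \<ge> T2 \<Longrightarrow> norm (v t - u) \<le> (M / 4 + S / \<eta>) * t powr (-\<eta>)"
    by (rule convergence_rate_of_dominated_derivative[of T2 \<eta> v v' \<phi> \<phi>' "M / 4 + S / \<eta>"])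
      (use T T2 \<eta> dv' d\<phi> v'le \<phi>low \<phi>up in auto)

  \<comment> \<open>The limit direction is an eigenvector\<close>
  have vlim: "(v \<longlongrightarrow> u) at_top"
  proof (rule LIM_zero_cancel[OF Lim_null_comparison])
    show "\<forall>\<^sub>F t in at_top. norm (v t - u) \<le> (M / 4 + S / \<eta>) * t powr (-\<eta>)"
      using eventually_ge_at_top[of T2] by eventually_elim (rule u)
    show "((\<lambda>t. (M / 4 + S / \<eta>) * t powr (-\<eta>)) \<longlongrightarrow> 0) at_top"
      using \<eta> by (intro tendsto_mult_right_zero tendsto_neg_powr filterlim_ident) simp
  qed
  have "\<forall>\<^sub>F t in at_top. norm (v t) = 1"
    using eventually_ge_at_top[of T] by eventually_elim (rule nv)
  then have "((\<lambda>t. norm (v t)) \<longlongrightarrow> 1) at_top" by (rule tendsto_eventually)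
  then have nu: "norm u = 1"
    using tendsto_unique[OF _ tendsto_norm[OF vlim]] by auto
  have wlim: "(w \<longlongrightarrow> ?B u) at_top"
    unfolding w_def
    by (intro tendsto_intros rqlim vlim bounded_linear.tendsto[OF matrix_vector_mul_bounded_linear])
  \<comment> \<open>Otherwise \<open>|w|^2\<close> would eventually exceed some
    \<open>m > 0\<close>, and \<open>E\<close> would decrease at least like
    \<open>- q * ln t\<close>, against \<open>E \<ge> 0\<close>.\<close>
  have "?B u = 0"
  proof (rule ccontr)
    assume nz: "?B u \<noteq> 0"
    define m where "m = (norm (?B u))\<^sup>2 / 2"
    have m: "m > 0" "m < (norm (?B u))\<^sup>2" using nz by (auto simp: m_def)
    have "((\<lambda>t. (norm (w t))\<^sup>2) \<longlongrightarrow> (norm (?B u))\<^sup>2) at_top"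
      by (intro tendsto_intros wlim)
    then have "\<forall>\<^sub>F t in at_top. m < (norm (w t))\<^sup>2" using m(2) by (rule order_tendstoD)
    then obtain T3 where T3: "\<And>t. t \<ge> T3 \<Longrightarrow> m < (norm (w t))\<^sup>2"
      by (auto simp: eventually_at_top_linorder)
    define T4 where "T4 = max T T3"
    define q where "q = 2 * h1 * m"
    have q: "q > 0" using h1 m by (simp add: q_def)
    have dF: "((\<lambda>t. E t + q * ln t) has_real_derivative (E' t + q / t)) (at t)" if "t \<ge> T4" for t
      using that pos[of t] by (auto intro!: derivative_eq_intros dE simp: T4_def)
    have F'0: "E' t + q / t \<le> 0" if "t \<ge> T4" for t
    proof -
      have t: "t \<ge> T" "t \<ge> T3" "t > 0" using that pos[of t] by (auto simp: T4_def)
      have "q / t = 2 * (h1 / t) * m" by (simp add: q_def)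
      also have "\<dots> \<le> 2 * h t * (norm (w t))\<^sup>2"
        using hl[OF t(1)] T3[OF t(2)] hpos[OF t(1)] h1 t m(1) by (intro mult_mono) auto
      finally show ?thesis using E'le[OF t(1)] by linarith
    qed
    have bound: "q * ln t \<le> E T4 + q * ln T4" if "t \<ge> T4" for t
      using nonincreasing_if_deriv_nonpos[OF dF F'0 order_refl that] E0[of t] that
      by (simp add: T4_def)
    have "\<forall>\<^sub>F t in at_top. ln t > (E T4 + q * ln T4) / q"
      using ln_at_top by (rule filterlim_at_top_dense[THEN iffD1, rule_format])
    then have "\<forall>\<^sub>F t::real in at_top. False"
      using eventually_ge_at_top[of T4]
    proof eventually_elim
      case (elim t)
      then show False using bound[of t] q by (simp add: field_simps)
    qed
    then show False by simp
  qed
  then have "A *v u = \<Lambda> *\<^sub>R u" by simp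
  with nu rqlim \<eta>(1) T2(1) u show thesis
    by (intro that[of u \<Lambda> \<eta> T2 "M / 4 + S / \<eta>"]) (auto simp: rq_def[abs_def])
qed

lemma has_real_derivative_norm:
  fixes y :: "real \<Rightarrow> 'a::real_inner"
  assumes "(y has_vector_derivative y') (at t)" "y t \<noteq> 0"
  shows "((\<lambda>t. norm (y t)) has_real_derivative (sgn (y t) \<bullet> y')) (at t)"
proof -
  have "((\<lambda>t. norm (y t)) has_derivative (\<lambda>h. (h *\<^sub>R y') \<bullet> sgn (y t))) (at t)"
    using has_derivative_compose[OF assms(1)[unfolded has_vector_derivative_def]
        has_derivative_norm[OF assms(2)]] by simp
  also have "(\<lambda>h. (h *\<^sub>R y') \<bullet> sgn (y t)) = (*) (sgn (y t) \<bullet> y')"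
    by (simp add: fun_eq_iff inner_commute)
  finally show ?thesis by (simp add: has_field_derivative_def)
qed

lemma has_vector_derivative_sgn:
  fixes y :: "real \<Rightarrow> 'a::real_inner"
  assumes "(y has_vector_derivative y') (at t)" "y t \<noteq> 0"
  shows "((\<lambda>t. sgn (y t)) has_vector_derivative
    ((1 / norm (y t)) *\<^sub>R (y' - (sgn (y t) \<bullet> y') *\<^sub>R sgn (y t)))) (at t)"
proof -
  have 1: "((\<lambda>t. inverse (norm (y t))) has_real_derivative
      (- (inverse (norm (y t)) * (sgn (y t) \<bullet> y') * inverse (norm (y t))))) (at t)"
    using assms by (intro DERIV_inverse' has_real_derivative_norm) auto
  have "((\<lambda>t. inverse (norm (y t)) *\<^sub>R y t) has_vector_derivative
      (inverse (norm (y t)) *\<^sub>R y' +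
        (- (inverse (norm (y t)) * (sgn (y t) \<bullet> y') * inverse (norm (y t)))) *\<^sub>R y t)) (at t)"
    by (rule has_vector_derivative_scaleR[OF 1 assms(1)])
  moreover have "inverse (norm (y t)) *\<^sub>R y' +
        (- (inverse (norm (y t)) * (sgn (y t) \<bullet> y') * inverse (norm (y t)))) *\<^sub>R y t
      = (1 / norm (y t)) *\<^sub>R (y' - (sgn (y t) \<bullet> y') *\<^sub>R sgn (y t))"
    by (simp add: sgn_div_norm scaleR_diff_right divide_inverse mult_ac)
  ultimately show ?thesis by (simp add: sgn_div_norm divide_inverse_commute)
qed

section \<open>Asymptotics of the solution\<close>

theorem theorem4p9:
  fixes A :: "real^'n^'n"
    and H :: "real^'n \<Rightarrow> real"
    and G :: "real \<Rightarrow> real^'n \<Rightarrow> real^'n"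
    and y :: "real \<Rightarrow> real^'n"
    and \<alpha> t0 T0 c r \<delta> \<Lambda> :: real
  assumes A_sym: "transpose A = A"
    and A_pos: "\<And>l. eigenvalue A l \<Longrightarrow> l > 0"
    and alpha: "\<alpha> > 0"
    and H_cont: "continuous_on UNIV H"
    and H_hom: "pos_homogeneous H \<alpha>"
    and H_pos: "\<And>x. x \<noteq> 0 \<Longrightarrow> H x > 0"
    and H_HC: "HC H {x. norm x = 1}"
    and t0: "t0 \<ge> 0"
    and G_cont: "continuous_on ({t0..} \<times> UNIV) (\<lambda>(t, x). G t x)"
    and params: "T0 \<ge> t0" "c > 0" "r > 0" "\<delta> > 0"
    and G_bound: "\<And>t x. t \<ge> T0 \<Longrightarrow> norm x \<le> r \<Longrightarrow> norm (G t x) \<le> c * norm x powr (1 + \<alpha> + \<delta>)"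
    and y_C1: "C1_on {t0..} y"
    and y_ode: "\<And>t. t > t0 \<Longrightarrow>
      (y has_vector_derivative (- (H (y t) *\<^sub>R (A *v y t)) + G t (y t))) (at t)"
    and y_nz: "\<And>t. t \<ge> t0 \<Longrightarrow> y t \<noteq> 0"
    and y_lim: "(y \<longlongrightarrow> 0) at_top"
    and Lambda: "\<Lambda> = Lim at_top (\<lambda>t. (y t \<bullet> (A *v y t)) / (norm (y t))\<^sup>2)"
  shows "\<exists>\<xi>. \<xi> \<noteq> 0 \<and>
    (\<exists>\<epsilon>>0. (\<lambda>t. norm (y t - (t powr (-1/\<alpha>)) *\<^sub>R \<xi>)) \<in> O[at_top](\<lambda>t. t powr (-1/\<alpha> - \<epsilon>))) \<and>
    eigenvector A \<xi> \<Lambda> \<and>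
    (\<exists>\<epsilon>>0. (\<lambda>t. norm (orth_proj (eigenspace A \<Lambda>) (y t) - (t powr (-1/\<alpha>)) *\<^sub>R \<xi>))
       \<in> O[at_top](\<lambda>t. t powr (-1/\<alpha> - \<epsilon>))) \<and>
    \<alpha> * \<Lambda> * H \<xi> = 1"
proof -

  \<comment> \<open>Bounds for \<open>A\<close>, and for \<open>H\<close> on the unit sphere\<close>
  obtain a where a: "a > 0" "\<And>x. a * (x \<bullet> x) \<le> x \<bullet> (A *v x)"
    using symmetric_positive_eigenvalues_coercive[OF A_sym A_pos] by blast
  obtain b where b: "b > 0" "\<And>x. norm (A *v x) \<le> b * norm x"
    using bounded_linear.pos_bounded[OF matrix_vector_mul_bounded_linear[of A]]
    by (metis mult.commute)
  have contH: "continuous_on (sphere 0 1) H"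
    using H_cont continuous_on_subset by blast
  have sphere_ne: "sphere (0::real^'n) 1 \<noteq> {}" by simp
  obtain x1 where x1: "norm x1 = 1" "\<And>x. norm x = 1 \<Longrightarrow> H x1 \<le> H x"
    using continuous_attains_inf[OF compact_sphere sphere_ne contH] by auto
  obtain x2 where x2: "norm x2 = 1" "\<And>x. norm x = 1 \<Longrightarrow> H x \<le> H x2"
    using continuous_attains_sup[OF compact_sphere sphere_ne contH] by auto
  define c1 where "c1 = H x1"
  define c2 where "c2 = H x2"
  have c1: "c1 > 0" "\<And>x. norm x = 1 \<Longrightarrow> c1 \<le> H x"
    using x1 H_pos[of x1] by (auto simp: c1_def simp flip: norm_eq_zero[of x1])
  have c2: "\<And>x. norm x = 1 \<Longrightarrow> H x \<le> c2"
    using x2 by (auto simp: c2_def)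
  have c20: "c2 > 0" using c1(1) c1(2)[OF x1(1)] c2[OF x1(1)] by linarith

  \<comment> \<open>Polar decomposition of the solution\<close>
  define n where "n t = norm (y t)" for t
  define v where "v t = sgn (y t)" for t
  define rq where "rq t = v t \<bullet> (A *v v t)" for t
  have n0: "(n \<longlongrightarrow> 0) at_top"
    using tendsto_norm[OF y_lim] by (simp add: n_def[abs_def])
  have n\<delta>: "((\<lambda>t. c * n t powr \<delta>) \<longlongrightarrow> 0) at_top"
  proof (intro tendsto_mult_right_zero)
    have "((\<lambda>t. n t powr \<delta>) \<longlongrightarrow> 0 powr \<delta>) at_top"
      using params(4) by (intro tendsto_powr'[OF n0 tendsto_const]) (auto simp: n_def)
    then show "((\<lambda>t. n t powr \<delta>) \<longlongrightarrow> 0) at_top" by simp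
  qed
  \<comment> \<open>\<open>c1 * a\<close> is the lower bound of \<open>H (v t) * rq t\<close>; a
    perturbation below half of it keeps the derivative of \<open>|y|^{-\<alpha>}\<close> bounded
    away from 0.\<close>
  have "\<forall>\<^sub>F t in at_top. n t < r \<and> c * n t powr \<delta> < c1 * a / 2"
    using order_tendstoD(2)[OF n0, of r] order_tendstoD(2)[OF n\<delta>, of "c1 * a / 2"] params a c1
    by (intro eventually_conj) auto
  then obtain T1' where T1': "\<And>t. t \<ge> T1' \<Longrightarrow> n t < r \<and> c * n t powr \<delta> < c1 * a / 2"
    by (auto simp: eventually_at_top_linorder)
  \<comment> \<open>The entry \<open>t0 + 1\<close> provides both \<open>t > t0\<close>, where the
    equation holds, and \<open>t \<ge> 1\<close>.\<close>
  define T1 where "T1 = max T1' (max T0 (t0 + 1))"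
  have T1: "t > t0" "t \<ge> T0" "t \<ge> 1" "n t < r" "c * n t powr \<delta> < c1 * a / 2" "n t > 0" "norm (v t) = 1"
    if "t \<ge> T1" for t
    using that T1'[of t] t0 y_nz[of t] by (auto simp: T1_def n_def v_def norm_sgn)
  have T11: "T1 \<ge> 1" using T1(3) by blast
  have y_polar: "y t = n t *\<^sub>R v t" for t
    by (cases "y t = 0") (simp_all add: n_def v_def sgn_div_norm)
  have H_polar: "H (y t) = n t powr \<alpha> * H (v t)" if "t \<ge> T1" for t
    using H_hom T1(6)[OF that] unfolding y_polar pos_homogeneous_def by blast
  have rq_bounds: "a \<le> rq t" "rq t \<le> b" if "t \<ge> T1" for t
  proof -
    have "v t \<bullet> v t = 1" using T1(7)[OF that] by (simp add: norm_eq_1)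
    then show "a \<le> rq t" using a(2)[of "v t"] by (simp add: rq_def)
    have "rq t \<le> norm (v t) * norm (A *v v t)" unfolding rq_def by (rule norm_cauchy_schwarz)
    then show "rq t \<le> b" using b(2)[of "v t"] T1(7)[OF that] by simp
  qed

  define Gt where "Gt t = G t (y t)" for t
  have Gt: "norm (Gt t) \<le> c * n t powr (1 + \<alpha> + \<delta>)" if "t \<ge> T1" for t
    using G_bound[of t "y t"] T1[OF that] by (simp add: Gt_def n_def)
  define y' where "y' t = - (H (y t) *\<^sub>R (A *v y t)) + Gt t" for t
  have dy: "(y has_vector_derivative y' t) (at t)" if "t \<ge> T1" for t
    using y_ode[OF T1(1)[OF that]] by (simp add: y'_def Gt_def)
  have vy': "v t \<bullet> y' t = - (n t powr (1 + \<alpha>) * H (v t) * rq t) + v t \<bullet> Gt t" if t: "t \<ge> T1" for t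
  proof -
    have "v t \<bullet> (H (y t) *\<^sub>R (A *v y t)) = n t powr \<alpha> * n t * H (v t) * rq t"
      unfolding H_polar[OF t] by (subst y_polar) (simp add: matrix_vector_mult_scaleR rq_def)
    also have "n t powr \<alpha> * n t = n t powr (1 + \<alpha>)"
      using T1(6)[OF t] by (simp add: powr_add)
    finally show ?thesis by (simp add: y'_def inner_diff_right)
  qed
  have vG: "\<bar>v t \<bullet> Gt t\<bar> \<le> c * n t powr (1 + \<alpha> + \<delta>)" if t: "t \<ge> T1" for t
    using Cauchy_Schwarz_ineq2[of "v t" "Gt t"] T1(7)[OF t] Gt[OF t] by simp

  \<comment> \<open>Linear growth of the power \<open>-\<alpha>\<close> of the norm\<close>
  define f where "f t = n t powr (-\<alpha>)" for t
  define f' where "f' t = \<alpha> * (H (v t) * rq t - n t powr (-1 - \<alpha>) * (v t \<bullet> Gt t))" for t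
  have f0: "f t > 0" if "t \<ge> T1" for t using T1(6)[OF that] by (simp add: f_def)
  have df: "(f has_real_derivative f' t) (at t)" if t: "t \<ge> T1" for t
  proof -
    have "(n has_real_derivative v t \<bullet> y' t) (at t)"
      using has_real_derivative_norm[OF dy[OF t]] y_nz[of t] T1(1)[OF t]
      by (simp add: n_def[abs_def] v_def)
    from DERIV_chain2[OF has_real_derivative_powr[OF T1(6)[OF t], of "-\<alpha>"] this]
    have "(f has_real_derivative - \<alpha> * n t powr (- \<alpha> - 1) * (v t \<bullet> y' t)) (at t)"
      unfolding f_def .
    \<comment> \<open>By homogeneity the radial velocity is of order
      \<open>n t powr (1 + \<alpha>)\<close>, and the factor in front cancels precisely this
      power.\<close>
    also have "- \<alpha> * n t powr (- \<alpha> - 1) * (v t \<bullet> y' t) = f' t"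
    proof -
      have "n t powr (-1 - \<alpha>) * n t powr (1 + \<alpha>) = 1"
        using T1(6)[OF t] by (simp flip: powr_add)
      then have "n t powr (-1 - \<alpha>) * (v t \<bullet> y' t) = - (H (v t) * rq t) + n t powr (-1 - \<alpha>) * (v t \<bullet> Gt t)"
        unfolding vy'[OF t] distrib_left by (simp flip: mult.assoc)
      moreover have "- \<alpha> - 1 = -1 - \<alpha>" by simp
      ultimately show ?thesis unfolding f'_def by (simp only: mult.assoc) (simp add: algebra_simps)
    qed
    finally show ?thesis .
  qed
  have f'_err: "\<bar>f' t - \<alpha> * (H (v t) * rq t)\<bar> \<le> \<alpha> * (c * n t powr \<delta>)" if t: "t \<ge> T1" for t
  proof -
    have "\<bar>f' t - \<alpha> * (H (v t) * rq t)\<bar> = \<alpha> * (n t powr (-1 - \<alpha>) * \<bar>v t \<bullet> Gt t\<bar>)"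
      using alpha by (simp add: f'_def right_diff_distrib abs_mult)
    also have "\<dots> \<le> \<alpha> * (n t powr (-1 - \<alpha>) * (c * n t powr (1 + \<alpha> + \<delta>)))"
      using vG[OF t] alpha by (intro mult_left_mono) auto
    also have "n t powr (-1 - \<alpha>) * (c * n t powr (1 + \<alpha> + \<delta>)) = c * n t powr \<delta>"
    proof -
      have "n t powr (-1 - \<alpha>) * n t powr (1 + \<alpha> + \<delta>) = n t powr \<delta>"
        by (simp flip: powr_add)
      then show ?thesis by simp
    qed
    finally show ?thesis .
  qed
  have Hrq: "c1 * a \<le> H (v t) * rq t" "H (v t) * rq t \<le> c2 * b" if t: "t \<ge> T1" for t
    using c1 c2[OF T1(7)[OF t]] c1(2)[OF T1(7)[OF t]] rq_bounds[OF t] a b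
    by (intro mult_mono; simp)+
  have f'lo: "\<alpha> * (c1 * a / 2) \<le> f' t" and f'hi: "f' t \<le> \<alpha> * (c2 * b + c1 * a / 2)"
    if t: "t \<ge> T1" for t
  proof -
    have "\<alpha> * (c * n t powr \<delta>) \<le> \<alpha> * (c1 * a / 2)"
      using T1(5)[OF t] alpha by simp
    moreover have "\<alpha> * (c1 * a) \<le> \<alpha> * (H (v t) * rq t)" "\<alpha> * (H (v t) * rq t) \<le> \<alpha> * (c2 * b)"
      using Hrq[OF t] alpha by simp_all
    ultimately show "\<alpha> * (c1 * a / 2) \<le> f' t" "f' t \<le> \<alpha> * (c2 * b + c1 * a / 2)"
      using f'_err[OF t] unfolding distrib_left by linarith+
  qed
  obtain lo hi where lh: "lo > 0" "hi > 0"
    and flo: "\<And>t. t \<ge> 2 * T1 \<Longrightarrow> lo * t \<le> f t" and fhi: "\<And>t. t \<ge> 2 * T1 \<Longrightarrow> f t \<le> hi * t"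
  proof (rule linear_growth_if_deriv_bounded[of T1 "\<alpha> * (c1 * a / 2)" f f' "\<alpha> * (c2 * b + c1 * a / 2)"])
    show "0 \<le> f T1" by (simp add: f_def)
  qed (use T11 alpha c1(1) a(1) df f'lo f'hi in auto)
  define T2 where "T2 = 2 * T1"
  have T2: "t \<ge> T1" "t > 0" "t \<ge> 1" "lo * t \<le> f t" "f t \<le> hi * t" if "t \<ge> T2" for t
    using that T11 flo fhi by (auto simp: T2_def)
  have n_f: "n t powr q = f t powr (- q / \<alpha>)" if "t \<ge> T1" for t q
    using alpha by (simp add: f_def powr_powr)
  \<comment> \<open>The exponent \<open>- q / \<alpha>\<close> is nonpositive, so the lower bound
    for \<open>f\<close> becomes an upper bound for \<open>n\<close>.\<close>
  have n_le: "n t powr q \<le> lo powr (- q / \<alpha>) * t powr (- q / \<alpha>)" if t: "t \<ge> T2" and "q \<ge> 0" for t q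
  proof -
    have "f t powr (- q / \<alpha>) \<le> (lo * t) powr (- q / \<alpha>)"
      using T2[OF t] lh \<open>q \<ge> 0\<close> alpha by (intro powr_mono2') auto
    then show ?thesis
      using n_f[OF T2(1)[OF t]] T2[OF t] lh by (simp add: powr_mult)
  qed

  \<comment> \<open>The equation of the direction and its limit\<close>
  define h where "h t = H (y t)" for t
  \<comment> \<open>\<open>|G| / |y|\<close> is at most
    \<open>c * n t powr (\<alpha> + \<delta>)\<close>, and \<open>n\<close> is of order
    \<open>t^{-1/\<alpha>}\<close>, which gives the order \<open>t powr (-1 - d)\<close>.\<close>
  define d where "d = \<delta> / \<alpha>"
  define g where "g t = (1 / n t) *\<^sub>R (Gt t - (v t \<bullet> Gt t) *\<^sub>R v t)" for t
  \<comment> \<open>The factor 2 accounts for \<open>Gt\<close> and its radial part.\<close>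
  define C where "C = 2 * c * lo powr (-1 - d)"
  have d0: "d > 0" using params alpha by (simp add: d_def)
  have h_f: "h t = H (v t) / f t" if t: "t \<ge> T1" for t
    using H_polar[OF t] by (simp add: h_def f_def powr_minus divide_inverse)
  have hl: "(c1 / hi) / t \<le> h t" and hu: "h t \<le> (c2 / lo) / t" if t: "t \<ge> T2" for t
  proof -
    have "c1 / (hi * t) \<le> H (v t) / f t"
      using T2[OF t] c1(1) c1(2)[OF T1(7)[OF T2(1)[OF t]]] f0[OF T2(1)[OF t]] lh
      by (intro frac_le) auto
    then show "(c1 / hi) / t \<le> h t" using h_f[OF T2(1)[OF t]] by simp
    have "H (v t) / f t \<le> c2 / (lo * t)"
      using T2[OF t] c20 c2[OF T1(7)[OF T2(1)[OF t]]] lh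
      by (intro frac_le) auto
    then show "h t \<le> (c2 / lo) / t" using h_f[OF T2(1)[OF t]] by simp
  qed
  have dv: "(v has_vector_derivative (- (h t *\<^sub>R (A *v v t - (v t \<bullet> (A *v v t)) *\<^sub>R v t)) + g t)) (at t)"
    if t: "t \<ge> T2" for t
  proof -
    have t1: "t \<ge> T1" using T2(1)[OF t] .
    have n: "n t > 0" using T1(6)[OF t1] .
    have "(v has_vector_derivative ((1 / n t) *\<^sub>R (y' t - (v t \<bullet> y' t) *\<^sub>R v t))) (at t)"
      using has_vector_derivative_sgn[OF dy[OF t1]] y_nz[of t] T1(1)[OF t1]
      by (simp add: v_def[abs_def] n_def)
    also have "(1 / n t) *\<^sub>R (y' t - (v t \<bullet> y' t) *\<^sub>R v t)
      = - (h t *\<^sub>R (A *v v t - (v t \<bullet> (A *v v t)) *\<^sub>R v t)) + g t"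
    proof -
      have y'_eq: "y' t = - ((h t * n t) *\<^sub>R (A *v v t)) + Gt t"
        unfolding y'_def h_def by (subst (2) y_polar) (simp add: matrix_vector_mult_scaleR)
      have "y' t - (v t \<bullet> y' t) *\<^sub>R v t
        = - (n t *\<^sub>R (h t *\<^sub>R (A *v v t - (v t \<bullet> (A *v v t)) *\<^sub>R v t)))
          + (Gt t - (v t \<bullet> Gt t) *\<^sub>R v t)"
        unfolding y'_eq by (simp add: inner_add_right algebra_simps)
      then show ?thesis using n by (simp add: g_def scaleR_add_right scaleR_diff_right[of "1 / n t" "Gt t - _"])
    qed
    finally show ?thesis .
  qed
  have gle: "norm (g t) \<le> C * t powr (-1 - d)" if t: "t \<ge> T2" for t
  proof -
    have t1: "t \<ge> T1" using T2(1)[OF t] .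
    have n: "n t > 0" using T1(6)[OF t1] .
    have "norm (Gt t - (v t \<bullet> Gt t) *\<^sub>R v t) \<le> norm (Gt t) + norm ((v t \<bullet> Gt t) *\<^sub>R v t)"
      by (rule norm_triangle_ineq4)
    also have "\<dots> \<le> 2 * c * n t powr (1 + \<alpha> + \<delta>)"
      using Gt[OF t1] vG[OF t1] T1(7)[OF t1] by simp
    finally have "norm (g t) \<le> 2 * c * n t powr (1 + \<alpha> + \<delta>) / n t"
      using n by (simp add: g_def divide_right_mono)
    also have "\<dots> = 2 * c * n t powr (\<alpha> + \<delta>)"
      using n by (simp add: powr_add)
    also have "\<dots> \<le> 2 * c * (lo powr (- (\<alpha> + \<delta>) / \<alpha>) * t powr (- (\<alpha> + \<delta>) / \<alpha>))"
      using n_le[OF t, of "\<alpha> + \<delta>"] alpha params by (intro mult_left_mono) auto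
    also have "- (\<alpha> + \<delta>) / \<alpha> = -1 - d" using alpha by (simp add: d_def field_simps)
    finally show ?thesis by (simp add: C_def)
  qed
  obtain u L T3 M \<eta> where u: "norm u = 1" "A *v u = L *\<^sub>R u"
    and rqlim: "((\<lambda>t. v t \<bullet> (A *v v t)) \<longlongrightarrow> L) at_top"
    and \<eta>: "\<eta> > 0" and T3: "T3 \<ge> T2" and vu: "\<And>t. t \<ge> T3 \<Longrightarrow> norm (v t - u) \<le> M * t powr (-\<eta>)"
  proof (rule rayleigh_flow_converges[OF A_sym _ d0 _ _ dv hl hu gle])
    show "T2 \<ge> 1" using T11 by (simp add: T2_def)
    show "c1 / hi > 0" using c1 lh by simp
    show "norm (v t) = 1" if "t \<ge> T2" for t using T1(7) T2(1) that by blast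
  qed blast+
  \<comment> \<open>\<open>\<Lambda>\<close> is given through \<open>Lim\<close>; its value is
    identified by the convergence \<open>rqlim\<close> of the same quotient written in
    \<open>v\<close>.\<close>
  have "(\<lambda>t. (y t \<bullet> (A *v y t)) / (norm (y t))\<^sup>2) = (\<lambda>t. v t \<bullet> (A *v v t))"
    by (simp add: fun_eq_iff v_def sgn_div_norm matrix_vector_mult_scaleR power2_eq_square divide_simps)
  then have L: "L = \<Lambda>"
    using tendsto_Lim[OF _ rqlim] Lambda by simp
  have u0: "u \<noteq> 0" using u(1) by auto
  have ev: "eigenvector A u \<Lambda>" using u u0 L by (simp add: eigenvector_def)
  have \<Lambda>0: "\<Lambda> > 0" using A_pos ev by (auto simp: eigenvalue_def)

  \<comment> \<open>Rates at the limit direction\<close>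
  obtain r0 C0 \<gamma> where HCu: "r0 > 0" "C0 > 0" "\<gamma> > 0"
    "\<And>x. norm x = 1 \<Longrightarrow> norm (x - u) < r0 \<Longrightarrow> \<bar>H x - H u\<bar> \<le> C0 * norm (x - u) powr \<gamma>"
    using H_HC u(1) unfolding HC_def by blast
  have "((\<lambda>t. M * t powr (-\<eta>)) \<longlongrightarrow> 0) at_top"
    using \<eta> by (intro tendsto_mult_right_zero tendsto_neg_powr filterlim_ident) simp
  \<comment> \<open>From here on \<open>v t\<close> stays within the radius of the Hoelder condition
    at \<open>u\<close>.\<close>
  then have "\<forall>\<^sub>F t in at_top. M * t powr (-\<eta>) < r0"
    using HCu(1) by (rule order_tendstoD)
  then obtain T4' where T4': "\<And>t. t \<ge> T4' \<Longrightarrow> M * t powr (-\<eta>) < r0"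
    by (auto simp: eventually_at_top_linorder)
  define T4 where "T4 = max T3 T4'"
  have T4: "t \<ge> T1" "t \<ge> T2" "t \<ge> T3" "t \<ge> T4'" "t \<ge> 1" "t > 0" if "t \<ge> T4" for t
    using that T3 T2(1,3)[of t] by (auto simp: T4_def)
  have M0: "M \<ge> 0"
  proof -
    have "0 \<le> M * T4 powr (-\<eta>)" using vu[OF T4(3)] norm_ge_zero order_trans by blast
    moreover have "T4 powr (-\<eta>) > 0" using T4(6)[of T4] by simp
    ultimately show ?thesis by (simp add: zero_le_mult_iff)
  qed

  \<comment> \<open>The rates of \<open>v\<close> and the Rayleigh quotient, of
    \<open>H (v t)\<close> through the Hoelder condition, and of the perturbation;
    \<open>1 / 2\<close> guarantees \<open>e < 1\<close>, as needed for integrating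
    \<open>t powr (-e)\<close>.\<close>
  define e where "e = Min {\<eta>, \<eta> * \<gamma>, d, 1 / 2}"
  have e: "e > 0" "e < 1" "e \<le> \<eta>" "e \<le> \<eta> * \<gamma>" "e \<le> d"
    using \<eta> HCu(3) d0 by (auto simp: e_def)
  have pe: "t powr (- q) \<le> t powr (- e)" if "t \<ge> T4" "e \<le> q" for t q
    using T4(5)[OF that(1)] that(2) by (intro powr_mono) auto
  have vue: "norm (v t - u) \<le> M * t powr (-e)" if t: "t \<ge> T4" for t
    using vu[OF T4(3)[OF t]] mult_left_mono[OF pe[OF t e(3)] M0] by linarith
  have rqe: "\<bar>rq t - \<Lambda>\<bar> \<le> 2 * b * M * t powr (-e)" if t: "t \<ge> T4" for t
  proof -
    have "u \<bullet> u = 1" using u(1) by (simp add: norm_eq_1)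
    then have "\<Lambda> = u \<bullet> (A *v u)" using u(2) L by simp
    then have "rq t - \<Lambda> = (v t - u) \<bullet> (A *v v t) + u \<bullet> (A *v (v t - u))"
      by (simp add: rq_def inner_diff_left inner_diff_right matrix_vector_mult_diff_distrib)
    then have "\<bar>rq t - \<Lambda>\<bar> \<le> \<bar>(v t - u) \<bullet> (A *v v t)\<bar> + \<bar>u \<bullet> (A *v (v t - u))\<bar>" by simp
    also have "\<dots> \<le> norm (v t - u) * norm (A *v v t) + norm u * norm (A *v (v t - u))"
      by (intro add_mono Cauchy_Schwarz_ineq2)
    also have "\<dots> \<le> norm (v t - u) * b + 1 * (b * norm (v t - u))"
      using b(2)[of "v t"] b(2)[of "v t - u"] T1(7)[OF T4(1)[OF t]] u(1)
      by (intro add_mono mult_mono) auto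
    also have "\<dots> = 2 * b * norm (v t - u)" by simp
    also have "\<dots> \<le> 2 * b * (M * t powr (-e))"
      using vue[OF t] b(1) by (intro mult_left_mono) auto
    finally show ?thesis by simp
  qed
  have He: "\<bar>H (v t) - H u\<bar> \<le> C0 * M powr \<gamma> * t powr (-e)" if t: "t \<ge> T4" for t
  proof -
    have "norm (v t - u) < r0"
      using vu[OF T4(3)[OF t]] T4'[OF T4(4)[OF t]] by linarith
    then have "\<bar>H (v t) - H u\<bar> \<le> C0 * norm (v t - u) powr \<gamma>"
      using HCu(4) T1(7)[OF T4(1)[OF t]] by blast
    also have "norm (v t - u) powr \<gamma> \<le> (M * t powr (-\<eta>)) powr \<gamma>"
      using vu[OF T4(3)[OF t]] HCu(3) by (intro powr_mono2) auto
    also have "(M * t powr (-\<eta>)) powr \<gamma> = M powr \<gamma> * t powr (- (\<eta> * \<gamma>))"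
      using M0 by (simp add: powr_mult powr_powr)
    also have "M powr \<gamma> * t powr (- (\<eta> * \<gamma>)) \<le> M powr \<gamma> * t powr (- e)"
      using pe[OF t e(4)] by (intro mult_left_mono) auto
    finally show ?thesis using HCu(2) by (simp add: mult.assoc)
  qed
  \<comment> \<open>\<open>K\<close> is the limit of \<open>f'\<close>, hence the slope of
    \<open>f\<close>.\<close>
  define K where "K = \<alpha> * (H u * \<Lambda>)"
  have K0: "K > 0" using alpha H_pos[OF u0] \<Lambda>0 by (simp add: K_def)
  \<comment> \<open>In this order the summands bound the deviation of the Rayleigh quotient, that of
    \<open>H (v t)\<close>, and the perturbation.\<close>
  define N where "N = \<alpha> * (c2 * (2 * b * M) + C0 * M powr \<gamma> * \<Lambda> + c * lo powr (- d))"
  have f'K: "\<bar>f' t - K\<bar> \<le> N * t powr (-e)" if t: "t \<ge> T4" for t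
  proof -
    let ?t = "t powr (-e)"
    have 1: "c * n t powr \<delta> \<le> c * lo powr (-d) * ?t"
    proof -
      have "n t powr \<delta> \<le> lo powr (- d) * t powr (- d)"
        using n_le[OF T4(2)[OF t], of \<delta>] params(4) by (simp add: d_def)
      also have "\<dots> \<le> lo powr (- d) * ?t"
        using pe[OF t e(5)] by (intro mult_left_mono) auto
      finally show ?thesis using params(2) by (simp add: mult.assoc)
    qed
    have 2: "\<bar>H (v t) * (rq t - \<Lambda>)\<bar> \<le> c2 * (2 * b * M * ?t)"
      unfolding abs_mult using rqe[OF t] c2[OF T1(7)[OF T4(1)[OF t]]] c1 c1(2)[OF T1(7)[OF T4(1)[OF t]]] c20
      by (intro mult_mono) auto
    have 3: "\<bar>(H (v t) - H u) * \<Lambda>\<bar> \<le> C0 * M powr \<gamma> * ?t * \<Lambda>"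
      unfolding abs_mult using He[OF t] \<Lambda>0 by (intro mult_mono) auto
    have "f' t - K = (f' t - \<alpha> * (H (v t) * rq t)) + \<alpha> * (H (v t) * (rq t - \<Lambda>) + (H (v t) - H u) * \<Lambda>)"
      by (simp add: K_def algebra_simps)
    then have "\<bar>f' t - K\<bar> \<le> \<bar>f' t - \<alpha> * (H (v t) * rq t)\<bar>
        + \<bar>\<alpha> * (H (v t) * (rq t - \<Lambda>) + (H (v t) - H u) * \<Lambda>)\<bar>" by simp
    also have "\<dots> \<le> \<alpha> * (c * n t powr \<delta>) + \<alpha> * (\<bar>H (v t) * (rq t - \<Lambda>)\<bar> + \<bar>(H (v t) - H u) * \<Lambda>\<bar>)"
      using f'_err[OF T4(1)[OF t]] alpha
      by (intro add_mono) (simp_all add: abs_mult[of \<alpha>] abs_triangle_ineq)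
    also have "\<dots> \<le> \<alpha> * (c * lo powr (-d) * ?t) + \<alpha> * (c2 * (2 * b * M * ?t) + C0 * M powr \<gamma> * ?t * \<Lambda>)"
      using 1 2 3 alpha by (intro add_mono mult_left_mono) auto
    also have "\<dots> = N * ?t" by (simp add: N_def algebra_simps)
    finally show ?thesis .
  qed
  obtain N' where N': "\<And>t. t \<ge> T4 \<Longrightarrow> \<bar>f t - K * t\<bar> \<le> N' * t powr (1 - e)"
    by (rule linear_asymptotics_of_deriv[of T4 e f f' K N])
      (use T4(1,5) e df f'K in auto)
  obtain P where P: "\<forall>\<^sub>F t in at_top. \<bar>f t powr (-1/\<alpha>) - (K * t) powr (-1/\<alpha>)\<bar> \<le> P * t powr (-1/\<alpha> - e)"
    by (rule powr_asymptotics[of T4 K e f N' "-1/\<alpha>"])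
      (use T4(1,6) K0 e(1) f0 N' in auto)

  \<comment> \<open>The limit vector and the error estimates\<close>
  define \<xi> where "\<xi> = K powr (-1/\<alpha>) *\<^sub>R u"
  have \<xi>0: "\<xi> \<noteq> 0" using u0 K0 by (simp add: \<xi>_def)
  have \<xi>ev: "eigenvector A \<xi> \<Lambda>"
    using \<xi>0 u(2) L by (simp add: eigenvector_def \<xi>_def matrix_vector_mult_scaleR)
  \<comment> \<open>Homogeneity gives \<open>H \<xi> = H u / K\<close>, which is
    \<open>1 / (\<alpha> * \<Lambda>)\<close> by the choice of \<open>K\<close>.\<close>
  have "H \<xi> = (K powr (-1/\<alpha>)) powr \<alpha> * H u"
    using H_hom K0 unfolding \<xi>_def pos_homogeneous_def by simp
  also have "(K powr (-1/\<alpha>)) powr \<alpha> = 1 / K"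
    using K0 alpha by (simp only: powr_powr) (simp add: powr_minus_divide)
  finally have H\<xi>: "\<alpha> * \<Lambda> * H \<xi> = 1"
    using alpha \<Lambda>0 H_pos[OF u0] by (simp add: K_def)

  define Q where "Q = lo powr (-1/\<alpha>) * M + P"
  have main: "\<forall>\<^sub>F t in at_top. norm (y t - (t powr (-1/\<alpha>)) *\<^sub>R \<xi>) \<le> Q * t powr (-1/\<alpha> - e)"
    using P eventually_ge_at_top[of T4]
  proof eventually_elim
    case (elim t)
    have n: "n t = f t powr (-1/\<alpha>)"
      using n_f[OF T4(1)[OF elim(2)], of 1] T1(6)[OF T4(1)[OF elim(2)]] by simp
    have "t powr (-1/\<alpha>) *\<^sub>R \<xi> = (K * t) powr (-1/\<alpha>) *\<^sub>R u"
      using K0 T4(6)[OF elim(2)] by (simp add: \<xi>_def powr_mult mult.commute)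
    \<comment> \<open>The first summand is the error of the direction, the second that of the
      length; they contribute the two parts of \<open>Q\<close>.\<close>
    then have "y t - t powr (-1/\<alpha>) *\<^sub>R \<xi> = n t *\<^sub>R (v t - u) + (n t - (K * t) powr (-1/\<alpha>)) *\<^sub>R u"
      using y_polar[of t] by (simp add: algebra_simps)
    then have "norm (y t - t powr (-1/\<alpha>) *\<^sub>R \<xi>)
      \<le> norm (n t *\<^sub>R (v t - u)) + norm ((n t - (K * t) powr (-1/\<alpha>)) *\<^sub>R u)"
      by (metis norm_triangle_ineq)
    also have "\<dots> = n t * norm (v t - u) + \<bar>n t - (K * t) powr (-1/\<alpha>)\<bar>"
      using u(1) by (simp add: n_def)
    also have "\<dots> \<le> lo powr (-1/\<alpha>) * t powr (-1/\<alpha>) * (M * t powr (-e)) + P * t powr (-1/\<alpha> - e)"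
    proof (intro add_mono mult_mono)
      show "n t \<le> lo powr (-1/\<alpha>) * t powr (-1/\<alpha>)"
        using n_le[OF T4(2)[OF elim(2)], of 1] T1(6)[OF T4(1)[OF elim(2)]] by simp
    qed (use elim vue[OF elim(2)] n in auto)
    also have "\<dots> = Q * t powr (-1/\<alpha> - e)"
    proof -
      have "t powr (-1/\<alpha> - e) = t powr (-1/\<alpha>) * t powr (-e)"
        by (subst powr_add[symmetric]) simp
      then show ?thesis by (simp add: Q_def algebra_simps)
    qed
    finally show ?case .
  qed
  have \<xi>S: "t powr (-1/\<alpha>) *\<^sub>R \<xi> \<in> eigenspace A \<Lambda>" for t
    using \<xi>ev by (simp add: eigenspace_def eigenvector_def matrix_vector_mult_scaleR)
  have bigo1: "(\<lambda>t. norm (y t - (t powr (-1/\<alpha>)) *\<^sub>R \<xi>)) \<in> O[at_top](\<lambda>t. t powr (-1/\<alpha> - e))"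
    by (rule bigoI[of _ Q]) (use main in simp)
  have bigo2: "(\<lambda>t. norm (orth_proj (eigenspace A \<Lambda>) (y t) - (t powr (-1/\<alpha>)) *\<^sub>R \<xi>))
       \<in> O[at_top](\<lambda>t. t powr (-1/\<alpha> - e))"
  proof (rule bigoI[of _ Q])
    show "\<forall>\<^sub>F t in at_top. norm (norm (orth_proj (eigenspace A \<Lambda>) (y t) - (t powr (-1/\<alpha>)) *\<^sub>R \<xi>))
        \<le> Q * norm (t powr (-1/\<alpha> - e))"
      using main
      by eventually_elim (use norm_orth_proj_diff_le[OF subspace_eigenspace \<xi>S] order_trans in \<open>simp, blast\<close>)
  qed
  show ?thesis
    using \<xi>0 \<xi>ev H\<xi> bigo1 bigo2 e(1) by blast
qed

end
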